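(* Let $\mathbf{z}=(z_n)$ be a sequence in $\mathbb{D}$ that is regular with respect to $\mathfrak{u}\in\beta\mathbb{N}\setminus\mathbb{N}$. Then, for each $\mathbf{k}=(k_n)\in \mathtt{Comp}_{\mathfrak{u}}(\mathbf{z})$, $\ker\zeta_{\mathbf{z},\mathfrak{u}}^{\mathbf{k},0}$ is a nonmaximal ideal of $H^\infty$ if and only if $\lim_{\mathfrak{u}}k_n=+\infty$.
   Context: $\mathbb{K}$ is an algebraically closed field, complete with respect to a nontrivial nonarchimedean absolute value $|\cdot|$; $\mathbb{D} = \{z \in \mathbb{K} : |z|<1\}$; $\mathbb{N}=\{1,2,\dots\}$; $\beta\mathbb{N}\setminus\mathbb{N}$ is the set of nonprincipal ultrafilters in $\mathbb{N}$. $H^\infty$ is the Banach $\mathbb{K}$-algebra of bounded power series $f(z)=\sum_{n\ge 0} a_n z^n$ on $\mathbb{D}$, with norm $\|f\| = \sup_n |a_n| = \sup_{z\in\mathbb{D}}|f(z)|$. For a seminorm $\varphi$ on $H^\infty$, $\ker\varphi = \{f\in H^\infty : \varphi(f)=0\}$. $D^+(z,r)$ is the closed disk with center $z$ and radius $r$, and for a disk $D\subset\mathbb{D}$, $\zeta_D(f) := \sup_{z\in D}|f(z)|$ for $f\in H^\infty$ (a multiplicative seminorm bounded by $\|\cdot\|$). A sequence $\mathbf{z}=(z_n)$ in $\mathbb{D}$ is regular with respect to $\mathfrak{u}$ if there is $C\in\mathfrak{u}$ with $\inf_{n\in C}\prod_{m\in C, m\ne n}|z_n-z_m|>0$. $\mathtt{Comp}_{\mathfrak{u}}(\mathbf{z})$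 is the set of all sequences $\mathbf{k}=(k_n)$ in $\mathbb{N}$ for which there is $C\in\mathfrak{u}$ with $\inf_{n\in C}\prod_{m\in C, m\ne n}|z_n-z_m|^{k_m}>0$. For $\mathbf{k}\in\mathtt{Comp}_{\mathfrak{u}}(\mathbf{z})$ and $r\in(0,1)$, $\zeta_{\mathbf{z},\mathfrak{u}}^{\mathbf{k},r} := \lim_{\mathfrak{u}}\zeta_{D^+(z_n,\sqrt[k_n]{r})}$ (pointwise limit along $\mathfrak{u}$), and $\zeta_{\mathbf{z},\mathfrak{u}}^{\mathbf{k},0} := \lim_{r\to 0^+}\zeta_{\mathbf{z},\mathfrak{u}}^{\mathbf{k},r}$ (pointwise limit, which exists by monotonicity in $r$). *)

theory Defs
  imports
    "HOL-Analysis.Analysis"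
    "HOL-Algebra.Ideal"
    "HOL-Computational_Algebra.Formal_Power_Series"
begin

text \<open>
  Algebraically closed fields that are complete with respect to a nontrivial nonarchimedean
  absolute value. Nonnegativity and definiteness of the absolute value follow from
  \<open>absv x = dist x 0\<close> and the metric space axioms. The library's \<open>norm\<close> is tied to real
  vector spaces and cannot be used here.
\<close>

class nonarch_field = alg_closed_field + complete_space +
  fixes absv :: "'a \<Rightarrow> real"
  assumes dist_absv: "dist x y = absv (x - y)"
    and absv_mult: "absv (x * y) = absv x * absv y"
    and absv_ultrametric: "absv (x + y) \<le> max (absv x) (absv y)"
    and absv_nontrivial: "\<exists>x. x \<noteq> 0 \<and> absv x \<noteq> 1"

definition unit_disk :: "'a::nonarch_field set" where
  "unit_disk = {z. absv z < 1}"

definition closed_disk :: "'a::nonarch_field \<Rightarrow> real \<Rightarrow> 'a set" where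
  "closed_disk c r = {w. absv (w - c) \<le> r}"

text \<open>
  The algebra of bounded power series, i.e. those of finite norm
  \<open>\<parallel>f\<parallel> = sup\<^sub>n |a\<^sub>n|\<close>; they converge on the open unit disk.
\<close>

definition Hinf :: "'a::nonarch_field fps ring" where
  "Hinf = \<lparr>carrier = {f. bdd_above (range (\<lambda>n. absv (fps_nth f n)))},
           mult = (*), one = 1, zero = 0, add = (+)\<rparr>"

definition evalH :: "'a::nonarch_field fps \<Rightarrow> 'a \<Rightarrow> 'a" where
  "evalH f z = (\<Sum>n. fps_nth f n * z ^ n)"

definition kerH :: "('a::nonarch_field fps \<Rightarrow> real) \<Rightarrow> 'a fps set" where
  "kerH \<phi> = {f \<in> carrier Hinf. \<phi> f = 0}"

definition zeta_disk :: "'a::nonarch_field set \<Rightarrow> 'a fps \<Rightarrow> real" where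
  "zeta_disk D f = (SUP z\<in>D. absv (evalH f z))"

text \<open>
  An ultrafilter is encoded as a proper filter \<open>U\<close>; its members are the sets \<open>C\<close> with
  \<open>eventually (\<lambda>n. n \<in> C) U\<close>, and limits along it are the library's filter limits.
\<close>

definition ultrafilter :: "'i filter \<Rightarrow> bool" where
  "ultrafilter U \<longleftrightarrow> U \<noteq> bot \<and> (\<forall>P. eventually P U \<or> eventually (\<lambda>x. \<not> P x) U)"

definition nonprincipal_ultrafilter :: "'i filter \<Rightarrow> bool" where
  "nonprincipal_ultrafilter U \<longleftrightarrow> ultrafilter U \<and> (\<forall>i. \<not> eventually (\<lambda>x. x = i) U)"

text \<open>
  The product of \<open>|z\<^sub>n - z\<^sub>m|\<^bsup>k\<^sub>m\<^esup>\<close> over \<open>m \<in> C\<close>, \<open>m \<noteq> n\<close>. For points of the unit disk the partial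
  products decrease, so their limit exists. It may be \<open>0\<close> without any factor vanishing, a case
  that \<open>prodinf\<close> would leave unspecified.
\<close>

definition sep_prod :: "(nat \<Rightarrow> 'a::nonarch_field) \<Rightarrow> (nat \<Rightarrow> nat) \<Rightarrow> nat set \<Rightarrow> nat \<Rightarrow> real" where
  "sep_prod z k C n = lim (\<lambda>N. \<Prod>m\<in>{m \<in> C. m < N \<and> m \<noteq> n}. absv (z n - z m) ^ k m)"

definition regular_wrt :: "nat filter \<Rightarrow> (nat \<Rightarrow> 'a::nonarch_field) \<Rightarrow> bool" where
  "regular_wrt U z \<longleftrightarrow>
     (\<exists>C. eventually (\<lambda>n. n \<in> C) U \<and> (INF n\<in>C. sep_prod z (\<lambda>_. 1) C n) > 0)"

definition Comp :: "nat filter \<Rightarrow> (nat \<Rightarrow> 'a::nonarch_field) \<Rightarrow> (nat \<Rightarrow> nat) set" where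
  "Comp U z = {k. (\<forall>n. k n \<ge> 1) \<and>
     (\<exists>C. eventually (\<lambda>n. n \<in> C) U \<and> (INF n\<in>C. sep_prod z k C n) > 0)}"

definition zeta ::
    "(nat \<Rightarrow> 'a::nonarch_field) \<Rightarrow> nat filter \<Rightarrow> (nat \<Rightarrow> nat) \<Rightarrow> real \<Rightarrow> 'a fps \<Rightarrow> real" where
  "zeta z U k r f = Lim U (\<lambda>n. zeta_disk (closed_disk (z n) (root (k n) r)) f)"

definition zeta0 ::
    "(nat \<Rightarrow> 'a::nonarch_field) \<Rightarrow> nat filter \<Rightarrow> (nat \<Rightarrow> nat) \<Rightarrow> 'a fps \<Rightarrow> real" where
  "zeta0 z U k f = Lim (at_right 0) (\<lambda>r. zeta z U k r f)"

end

theory Submission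
  imports Defs "HOL-Computational_Algebra.Polynomial_FPS"
begin

text \<open>
  Write \<open>J\<close> for the ideal of all \<open>f\<close> with \<open>f(z\<^sub>n) \<rightarrow> 0\<close> along \<open>U\<close>. Since the disks around \<open>z\<^sub>n\<close> contain
  \<open>z\<^sub>n\<close>, the kernel of \<open>\<zeta>\<^bsup>k,0\<^esup>\<close> is contained in \<open>J\<close>. The ideal \<open>J\<close> is maximal, and the kernel is all of
  \<open>J\<close> precisely when \<open>k\<close> does not tend to infinity along \<open>U\<close>.

  Both the maximality of \<open>J\<close> and the strictness of the inclusion rest on one construction, an
  interpolation theorem (\<open>interpolation_on_separated_set\<close>): if the products
  \<open>\<Prod>|w - v|\<close> over \<open>v \<in> S\<close>, \<open>v \<noteq> w\<close>, are bounded below uniformly in \<open>w \<in> S\<close>, then every bounded function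
  on \<open>S\<close> is the restriction of a bounded power series. Regularity of \<open>z\<close> says that the points \<open>z\<^sub>n\<close> with
  \<open>n\<close> in a suitable member \<open>C\<close> of \<open>U\<close> form such a set.

  \<^item> Maximality of \<open>J\<close>: if \<open>f \<notin> J\<close>, then \<open>|f|\<close> is bounded below at \<open>U\<close>-almost all \<open>z\<^sub>n\<close>; interpolating
    \<open>1/f(z\<^sub>n)\<close> there gives \<open>g\<close> with \<open>1 - g f \<in> J\<close>.

  \<^item> If \<open>k\<close> does not tend to infinity, it is bounded on a member of \<open>U\<close>, so the radii \<open>r\<^bsup>1/k\<^sub>n\<^esup>\<close> tend to
    \<open>0\<close> uniformly with \<open>r\<close>. Bounded power series are Lipschitz on the disk, so the kernel is \<open>J\<close>.

  \<^item> If \<open>k\<close> tends to infinity, then for each fixed \<open>r > 0\<close> the radii tend to \<open>1\<close>. Take \<open>p \<noteq> 0\<close> with \<open>|p|\<close>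
    below the separation constant. Adjoining the points \<open>z\<^sub>n + p\<close> keeps the set separated, so some
    \<open>f\<close> vanishes at all \<open>z\<^sub>n\<close> and equals \<open>1\<close> at all \<open>z\<^sub>n + p\<close>, \<open>n \<in> C\<close>. It lies in \<open>J\<close>, but \<open>z\<^sub>n + p\<close>
    eventually belongs to the \<open>n\<close>-th disk for every \<open>r\<close>, so it is not in the kernel.

  The interpolation theorem needs care because infinite products \<open>\<Prod>(1 - z/m)\<close> over points \<open>m\<close> with
  \<open>|m| \<rightarrow> 1\<close> diverge, already in the coefficient \<open>-\<Sum>1/m\<close> of \<open>z\<close>, and bounded families of power series
  need not have convergent subsequences. The remedy is to use the factors \<open>1 - (z/m)\<^bsup>N(m)\<^esup>\<close> instead. They still vanish
  at \<open>m\<close>; they agree with \<open>1\<close> to the order \<open>N(m)\<close>, so their product stabilizes coefficient by coefficient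
  as soon as \<open>N(m) \<rightarrow> \<infinity>\<close>; and if \<open>N\<close> grows slowly enough, the product of their norms \<open>|m|\<^bsup>-N(m)\<^esup>\<close> stays
  finite. Their extra zeros are harmless, since the absolute value of such a factor is exactly \<open>1\<close>
  wherever \<open>|z| < |m|\<close>. The basis function for a point \<open>n\<close> of \<open>S\<close> therefore uses these factors for the
  points \<open>m\<close> with \<open>|m| > |n|\<close>, ordinary Lagrange factors \<open>(z - m)/(n - m)\<close> for the finitely many other
  points, and \<open>(z/n)\<^bsup>N(n)\<^esup>\<close> to make the sum over all \<open>n\<close> finite in each coefficient.
\<close>

unbundle no vec_syntax
unbundle fps_syntax

section \<open>Arithmetic and topology of the absolute value\<close>

lemma absv_eq_dist: "absv x = dist x (0::'a::nonarch_field)"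
  by (simp add: dist_absv)

lemma absv_nonneg [simp]: "0 \<le> absv (x::'a::nonarch_field)"
  by (simp add: absv_eq_dist)

lemma absv_eq_0_iff [simp]: "absv x = 0 \<longleftrightarrow> (x::'a::nonarch_field) = 0"
  by (simp add: absv_eq_dist)

lemma absv_0 [simp]: "absv (0::'a::nonarch_field) = 0"
  by simp

lemma absv_pos_iff [simp]: "0 < absv x \<longleftrightarrow> (x::'a::nonarch_field) \<noteq> 0"
  by (simp add: less_le)

lemma absv_le_0_iff [simp]: "absv x \<le> 0 \<longleftrightarrow> (x::'a::nonarch_field) = 0"
  by (simp add: order_antisym_conv)

lemma absv_not_less_0 [simp]: "\<not> absv (x::'a::nonarch_field) < 0"
  by (simp add: not_less)

lemma absv_1 [simp]: "absv (1::'a::nonarch_field) = 1"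
  using absv_mult[of "1::'a" 1] by simp

lemma absv_minus [simp]: "absv (- x) = absv (x::'a::nonarch_field)"
  using dist_commute[of x 0] dist_absv[of x 0] dist_absv[of 0 x] by simp

lemma absv_minus_commute: "absv (x - y) = absv (y - (x::'a::nonarch_field))"
  using absv_minus[of "x - y"] by simp

lemma absv_diff_le: "absv (x - y) \<le> max (absv x) (absv (y::'a::nonarch_field))"
  using absv_ultrametric[of x "- y"] by simp

lemma absv_power: "absv (x ^ n) = absv (x::'a::nonarch_field) ^ n"
  by (induction n) (auto simp: absv_mult)

lemma absv_inverse: "absv (inverse x) = inverse (absv (x::'a::nonarch_field))"
proof (cases "x = 0")
  case False
  then have "absv x * absv (inverse x) = 1"
    by (simp flip: absv_mult)
  then show ?thesis by (simp add: inverse_unique)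
qed auto

lemma absv_divide: "absv (x / y) = absv x / absv (y::'a::nonarch_field)"
  by (simp add: divide_inverse absv_mult absv_inverse)

lemma absv_prod: "absv (\<Prod>i\<in>A. f i :: 'a::nonarch_field) = (\<Prod>i\<in>A. absv (f i))"
  by (induction A rule: infinite_finite_induct) (auto simp: absv_mult)

lemma absv_sum_le:
  fixes f :: "'i \<Rightarrow> 'a::nonarch_field"
  assumes "\<And>i. i \<in> A \<Longrightarrow> absv (f i) \<le> M" "0 \<le> M"
  shows "absv (\<Sum>i\<in>A. f i) \<le> M"
  using assms
proof (induction A rule: infinite_finite_induct)
  case (insert x F)
  then show ?case using absv_ultrametric[of "f x" "sum f F"] by fastforce
qed auto

lemma absv_add_eq_right:
  fixes x y :: "'a::nonarch_field"
  assumes "absv x < absv y"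
  shows "absv (x + y) = absv y"
  using absv_ultrametric[of x y] absv_diff_le[of "x + y" x] assms by auto

lemma absv_diff_eq_right:
  fixes x y :: "'a::nonarch_field"
  assumes "absv x < absv y"
  shows "absv (x - y) = absv y"
  using absv_add_eq_right[of x "- y"] assms by simp

lemma tendsto_iff_absv:
  "(f \<longlongrightarrow> (l::'a::nonarch_field)) F \<longleftrightarrow> ((\<lambda>x. absv (f x - l)) \<longlongrightarrow> 0) F"
  by (subst tendsto_dist_iff) (simp add: dist_absv)

text \<open>
  Powers of an element with \<open>|x| < 1\<close> are arbitrarily small; nontriviality provides such an element,
  after inversion if necessary.
\<close>

lemma ex_small_absv:
  assumes "0 < (e::real)"
  shows "\<exists>x::'a::nonarch_field. x \<noteq> 0 \<and> absv x < e"
proof -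
  obtain x :: 'a where x: "x \<noteq> 0" "absv x \<noteq> 1" using absv_nontrivial by blast
  define y where "y = (if absv x < 1 then x else inverse x)"
  have y: "y \<noteq> 0" "absv y < 1"
    using x by (auto simp: y_def absv_inverse inverse_less_1_iff)
  obtain n where "absv y ^ n < e" using real_arch_pow_inv[OF assms y(2)] by blast
  with y show ?thesis by (intro exI[of _ "y ^ n"]) (auto simp: absv_power)
qed

lemma tendsto_absv: "(f \<longlongrightarrow> (l::'a::nonarch_field)) F \<Longrightarrow> ((\<lambda>x. absv (f x)) \<longlongrightarrow> absv l) F"
  unfolding absv_eq_dist by (intro tendsto_intros)

text \<open>
  The ultrametric inequality makes addition and multiplication continuous, which gives access to
  the general calculus of limits and series.
\<close>

instance nonarch_field \<subseteq> topological_ab_group_add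
proof
  fix a b :: 'a
  let ?F = "nhds a \<times>\<^sub>F nhds b"
  have "((\<lambda>x. max (absv (fst x - a)) (absv (snd x - b))) \<longlongrightarrow> max 0 0) ?F"
    using filterlim_fst[of "nhds a" "nhds b"] filterlim_snd[of "nhds b" "nhds a"]
    by (intro tendsto_max) (rule tendsto_iff_absv[THEN iffD1], assumption)+
  then have lim: "((\<lambda>x. max (absv (fst x - a)) (absv (snd x - b))) \<longlongrightarrow> 0) ?F"
    by simp
  have le: "absv (fst x + snd x - (a + b)) \<le> max (absv (fst x - a)) (absv (snd x - b))" for x :: "'a \<times> 'a"
    using absv_ultrametric[of "fst x - a" "snd x - b"] by (simp add: algebra_simps)
  show "((\<lambda>x. fst x + snd x) \<longlongrightarrow> a + b) ?F"
    by (rule tendsto_iff_absv[THEN iffD2], rule tendsto_sandwich[OF _ _ tendsto_const lim]) (use le in auto)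
  have "((\<lambda>x. absv (x - a)) \<longlongrightarrow> 0) (nhds a)"
    using filterlim_ident[of "nhds a"] by (rule tendsto_iff_absv[THEN iffD1])
  moreover have "absv (- x - - a) = absv (x - a)" for x
    using absv_minus[of "x - a"] by (simp add: algebra_simps)
  ultimately show "(uminus \<longlongrightarrow> - a) (nhds a)"
    by (subst tendsto_iff_absv) simp
qed

instance nonarch_field \<subseteq> topological_semigroup_mult
proof
  fix a b :: 'a
  let ?F = "nhds a \<times>\<^sub>F nhds b"
  let ?u = "\<lambda>x. absv (fst x - a)" and ?v = "\<lambda>x. absv (snd x - b)"
  have uv: "(?u \<longlongrightarrow> 0) ?F" "(?v \<longlongrightarrow> 0) ?F"
    using filterlim_fst[of "nhds a" "nhds b"] filterlim_snd[of "nhds b" "nhds a"]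
    by (simp_all only: tendsto_iff_absv[of fst a] tendsto_iff_absv[of snd b])
  have "((\<lambda>x. max (max (?u x * ?v x) (?u x * absv b)) (absv a * ?v x)) \<longlongrightarrow> max (max (0 * 0) (0 * absv b)) (absv a * 0)) ?F"
    by (intro tendsto_intros uv)
  then have lim: "((\<lambda>x. max (max (?u x * ?v x) (?u x * absv b)) (absv a * ?v x)) \<longlongrightarrow> 0) ?F"
    by simp
  have le: "absv (fst x * snd x - a * b) \<le> max (max (?u x * ?v x) (?u x * absv b)) (absv a * ?v x)" for x :: "'a \<times> 'a"
  proof -
    let ?p = "(fst x - a) * (snd x - b)" and ?q = "(fst x - a) * b" and ?r = "a * (snd x - b)"
    have "fst x * snd x - a * b = (?p + ?q) + ?r"
      by (simp add: algebra_simps)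
    then show ?thesis
      using absv_ultrametric[of "?p + ?q" ?r] absv_ultrametric[of ?p ?q]
      by (simp add: absv_mult)
  qed
  show "((\<lambda>x. fst x * snd x) \<longlongrightarrow> a * b) ?F"
    by (rule tendsto_iff_absv[THEN iffD2], rule tendsto_sandwich[OF _ _ tendsto_const lim]) (use le in auto)
qed

section \<open>Bounded power series and their values\<close>

text \<open>
  An explicit upper bound for the norm. It is easier to propagate through sums, products and limits
  than the supremum itself.
\<close>

definition coeff_le :: "real \<Rightarrow> 'a::nonarch_field fps \<Rightarrow> bool" where
  "coeff_le M f \<longleftrightarrow> (\<forall>n. absv (f $ n) \<le> M)"

lemma coeff_leD: "coeff_le M f \<Longrightarrow> absv (f $ n) \<le> M"
  by (simp add: coeff_le_def)

lemma coeff_le_nonneg: "coeff_le M f \<Longrightarrow> 0 \<le> M"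
  using order_trans[OF absv_nonneg coeff_leD] .

lemma coeff_le_mono: "coeff_le M f \<Longrightarrow> M \<le> N \<Longrightarrow> coeff_le N f"
  by (auto simp: coeff_le_def intro: order_trans)

lemma carrier_Hinf_iff: "f \<in> carrier Hinf \<longleftrightarrow> (\<exists>M. coeff_le M f)"
  by (auto simp: Hinf_def bdd_above_def coeff_le_def)

lemma coeff_le_add: "coeff_le M f \<Longrightarrow> coeff_le M g \<Longrightarrow> coeff_le M (f + g)"
  unfolding coeff_le_def fps_add_nth
  using absv_ultrametric by (metis max.boundedI order_trans)

lemma coeff_le_diff: "coeff_le M f \<Longrightarrow> coeff_le M g \<Longrightarrow> coeff_le M (f - g)"
  unfolding coeff_le_def fps_sub_nth
  using absv_diff_le by (metis max.boundedI order_trans)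

lemma coeff_le_sum:
  "(\<And>i. i \<in> A \<Longrightarrow> coeff_le M (f i)) \<Longrightarrow> 0 \<le> M \<Longrightarrow> coeff_le M (\<Sum>i\<in>A. f i)"
  unfolding coeff_le_def by (simp add: fps_sum_nth absv_sum_le)

text \<open>
  Submultiplicativity of the norm: each coefficient of the product is a finite sum, which the
  ultrametric inequality bounds by its largest term.
\<close>

lemma coeff_le_mult:
  assumes f: "coeff_le M f" and g: "coeff_le N g"
  shows "coeff_le (M * N) (f * g)"
proof -
  have "absv (\<Sum>i=0..n. f $ i * g $ (n - i)) \<le> M * N" for n
  proof (rule absv_sum_le)
    show "absv (f $ i * g $ (n - i)) \<le> M * N" for i
      unfolding absv_mult
      by (intro mult_mono coeff_leD[OF f] coeff_leD[OF g] coeff_le_nonneg[OF f] absv_nonneg)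
    show "0 \<le> M * N" using coeff_le_nonneg[OF f] coeff_le_nonneg[OF g] by simp
  qed
  then show ?thesis by (simp add: coeff_le_def fps_mult_nth)
qed

lemma coeff_le_1: "coeff_le 1 1"
  by (simp add: coeff_le_def)

lemma coeff_le_prod:
  assumes "\<And>i. i \<in> A \<Longrightarrow> coeff_le (M i) (f i)"
  shows "coeff_le (\<Prod>i\<in>A. M i) (\<Prod>i\<in>A. f i)"
  using assms
  by (induction A rule: infinite_finite_induct) (auto intro: coeff_le_mult coeff_le_1)

lemma coeff_le_const: "coeff_le (absv c) (fps_const c)"
  by (simp add: coeff_le_def)

lemma coeff_le_X_power: "coeff_le 1 (fps_X ^ n)"
  by (simp add: coeff_le_def fps_X_power_nth)

lemma Hinf_1 [simp]: "1 \<in> carrier Hinf"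
  unfolding carrier_Hinf_iff using coeff_le_1 by blast

lemma Hinf_0 [simp]: "0 \<in> carrier Hinf"
  by (auto simp: carrier_Hinf_iff coeff_le_def)

lemma Hinf_add [simp]: "f \<in> carrier Hinf \<Longrightarrow> g \<in> carrier Hinf \<Longrightarrow> f + g \<in> carrier Hinf"
proof -
  assume "f \<in> carrier Hinf" "g \<in> carrier Hinf"
  then obtain M N where "coeff_le M f" "coeff_le N g" by (auto simp: carrier_Hinf_iff)
  then have "coeff_le (max M N) (f + g)"
    by (intro coeff_le_add; elim coeff_le_mono) auto
  then show ?thesis by (auto simp: carrier_Hinf_iff)
qed

lemma Hinf_minus [simp]: "f \<in> carrier Hinf \<Longrightarrow> - f \<in> carrier Hinf"
  unfolding carrier_Hinf_iff coeff_le_def by simp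

lemma Hinf_diff [simp]: "f \<in> carrier Hinf \<Longrightarrow> g \<in> carrier Hinf \<Longrightarrow> f - g \<in> carrier Hinf"
  using Hinf_add[of f "- g"] by simp

lemma Hinf_mult [simp]: "f \<in> carrier Hinf \<Longrightarrow> g \<in> carrier Hinf \<Longrightarrow> f * g \<in> carrier Hinf"
  unfolding carrier_Hinf_iff using coeff_le_mult by blast

lemma Hinf_const [simp]: "fps_const c \<in> carrier Hinf"
  unfolding carrier_Hinf_iff using coeff_le_const by blast

lemma Hinf_X_power [simp]: "fps_X ^ n \<in> carrier Hinf"
  unfolding carrier_Hinf_iff using coeff_le_X_power by blast

lemma Hinf_X [simp]: "fps_X \<in> carrier Hinf"
  using Hinf_X_power[of 1] by simp

lemma Hinf_sum [simp]: "(\<And>i. i \<in> A \<Longrightarrow> f i \<in> carrier Hinf) \<Longrightarrow> (\<Sum>i\<in>A. f i) \<in> carrier Hinf"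
  by (induction A rule: infinite_finite_induct) auto

lemma Hinf_prod [simp]: "(\<And>i. i \<in> A \<Longrightarrow> f i \<in> carrier Hinf) \<Longrightarrow> (\<Prod>i\<in>A. f i) \<in> carrier Hinf"
  by (induction A rule: infinite_finite_induct) auto

lemma cring_Hinf: "cring (Hinf :: 'a::nonarch_field fps ring)"
proof (rule cringI)
  show "abelian_group (Hinf :: 'a fps ring)"
  proof (rule abelian_groupI)
    fix x :: "'a fps" assume "x \<in> carrier Hinf"
    then have "- x \<in> carrier Hinf" by simp
    then show "\<exists>y\<in>carrier Hinf. y \<oplus>\<^bsub>Hinf\<^esub> x = \<zero>\<^bsub>Hinf\<^esub>"
      by (intro bexI[of _ "- x"]) (simp_all add: Hinf_def)
  qed (use Hinf_add Hinf_0 in \<open>simp_all add: Hinf_def algebra_simps\<close>)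
  show "comm_monoid (Hinf :: 'a fps ring)"
    by (rule comm_monoidI) (use Hinf_mult Hinf_1 in \<open>simp_all add: Hinf_def algebra_simps\<close>)
qed (simp add: Hinf_def algebra_simps)

text \<open>
  The terms are dominated by \<open>M |z|\<^sup>n\<close>, and by the ultrametric inequality so are the tails of the
  partial sums; completeness does the rest.
\<close>

lemma evalH_sums:
  assumes f: "f \<in> carrier Hinf" and z: "absv z < 1"
  shows "(\<lambda>n. f $ n * z ^ n) sums evalH f z"
proof -
  obtain M where M: "coeff_le M f" using f carrier_Hinf_iff by blast
  have M0: "0 \<le> M" using coeff_le_nonneg[OF M] .
  let ?s = "\<lambda>n. \<Sum>i<n. f $ i * z ^ i"
  have "Cauchy ?s"
  proof (rule CauchyI')
    fix e :: real assume e: "0 < e"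
    obtain N where N: "absv z ^ N < e / (M + 1)"
      using real_arch_pow_inv[OF _ z, of "e / (M + 1)"] e M0 by auto
    have "dist (?s m) (?s n) < e" if "N \<le> m" "m < n" for m n
    proof -
      have "absv (\<Sum>i\<in>{m..<n}. f $ i * z ^ i) \<le> M * absv z ^ N"
      proof (rule absv_sum_le)
        fix i assume "i \<in> {m..<n}"
        then have "absv z ^ i \<le> absv z ^ N"
          using that z by (intro power_decreasing) auto
        then show "absv (f $ i * z ^ i) \<le> M * absv z ^ N"
          using M0 coeff_leD[OF M] by (auto simp: absv_mult absv_power intro!: mult_mono)
      qed (use M0 in auto)
      also have "\<dots> \<le> (M + 1) * absv z ^ N" by (simp add: algebra_simps)
      also have "\<dots> < e" using N M0 by (simp add: field_simps)
      finally have "absv (?s n - ?s m) < e"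
        using sum_diff_nat_ivl[of 0 m n "\<lambda>i. f $ i * z ^ i"] that by (simp add: atLeast0LessThan)
      then show ?thesis by (simp add: dist_absv absv_minus_commute)
    qed
    then show "\<exists>N. \<forall>m\<ge>N. \<forall>n>m. dist (?s m) (?s n) < e" by blast
  qed
  then have "convergent ?s" by (rule Cauchy_convergent)
  then have "summable (\<lambda>n. f $ n * z ^ n)"
    by (simp add: summable_iff_convergent)
  then show ?thesis unfolding evalH_def by (rule summable_sums)
qed

lemma evalH_add:
  assumes "f \<in> carrier Hinf" "g \<in> carrier Hinf" "absv z < 1"
  shows "evalH (f + g) z = evalH f z + evalH g z"
proof -
  have "(\<lambda>n. (f + g) $ n * z ^ n) sums (evalH f z + evalH g z)"
    using tendsto_add[OF evalH_sums[OF assms(1,3), unfolded sums_def] evalH_sums[OF assms(2,3), unfolded sums_def]]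
    by (simp add: sums_def sum.distrib algebra_simps)
  then show ?thesis using evalH_sums[of "f + g" z] assms sums_unique2 by auto
qed

lemma evalH_minus:
  assumes "f \<in> carrier Hinf" "absv z < 1"
  shows "evalH (- f) z = - evalH f z"
proof -
  have "(\<lambda>n. (- f) $ n * z ^ n) sums (- evalH f z)"
    using tendsto_minus[OF evalH_sums[OF assms, unfolded sums_def]]
    by (simp add: sums_def sum_negf)
  then show ?thesis using evalH_sums[of "- f" z] assms sums_unique2 by auto
qed

lemma evalH_diff:
  assumes "f \<in> carrier Hinf" "g \<in> carrier Hinf" "absv z < 1"
  shows "evalH (f - g) z = evalH f z - evalH g z"
  using evalH_add[of f "- g" z] evalH_minus[of g z] assms by simp

lemma evalH_fps_of_poly: "evalH (fps_of_poly p) z = poly p z"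
proof -
  have "(\<Sum>n. coeff p n * z ^ n) = (\<Sum>n\<le>degree p. coeff p n * z ^ n)"
    by (rule suminf_finite) (auto simp: coeff_eq_0)
  then show ?thesis by (simp add: evalH_def poly_altdef)
qed

lemma evalH_1 [simp]: "evalH 1 z = 1"
  using evalH_fps_of_poly[of 1] by simp

lemma evalH_0 [simp]: "evalH 0 z = 0"
  using evalH_fps_of_poly[of 0] by simp

lemma evalH_const [simp]: "evalH (fps_const c) z = c"
  using evalH_fps_of_poly[of "[:c:]"] by (simp add: fps_of_poly_const)

lemma evalH_X [simp]: "evalH fps_X z = z"
  using evalH_fps_of_poly[of "[:0, 1:]"] by simp

lemma absv_evalH_le_tail:
  assumes M: "coeff_le M f" and z: "absv z < 1" and low: "\<And>i. i < j \<Longrightarrow> f $ i = 0"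
  shows "absv (evalH f z) \<le> M * absv z ^ j"
proof -
  have M0: "0 \<le> M" using coeff_le_nonneg[OF M] .
  have "f \<in> carrier Hinf" using M carrier_Hinf_iff by blast
  then have "((\<lambda>n. absv (\<Sum>i<n. f $ i * z ^ i)) \<longlongrightarrow> absv (evalH f z)) sequentially"
    using evalH_sums[OF _ z] tendsto_absv unfolding sums_def by blast
  moreover have "absv (\<Sum>i<n. f $ i * z ^ i) \<le> M * absv z ^ j" for n
  proof (rule absv_sum_le)
    fix i
    show "absv (f $ i * z ^ i) \<le> M * absv z ^ j"
    proof (cases "i < j")
      case False
      then have "absv z ^ i \<le> absv z ^ j" using z by (intro power_decreasing) auto
      then show ?thesis
        using M0 coeff_leD[OF M] by (auto simp: absv_mult absv_power intro!: mult_mono)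
    qed (use low M0 in auto)
  qed (use M0 in auto)
  ultimately show ?thesis using Lim_bounded by blast
qed

lemma absv_evalH_le:
  "coeff_le M f \<Longrightarrow> absv z < 1 \<Longrightarrow> absv (evalH f z) \<le> M"
  using absv_evalH_le_tail[of M f z 0] by simp

text \<open>
  This replaces a compactness argument: for a norm-bounded sequence, stabilization of each coefficient
  forces convergence of the values, because \<open>F j - f\<close> starts at the power \<open>z\<^bsup>j+1\<^esup>\<close>. All infinite sums
  and products of power series below are controlled through this lemma.
\<close>

lemma evalH_tendsto:
  assumes F: "\<And>j. coeff_le M (F j)" and agree: "\<And>i j. i \<le> j \<Longrightarrow> F j $ i = f $ i"
    and z: "absv z < 1"
  shows "(\<lambda>j. evalH (F j) z) \<longlonglongrightarrow> evalH f z"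
proof -
  have f: "coeff_le M f"
    unfolding coeff_le_def agree[OF order_refl, symmetric] using coeff_leD[OF F] by blast
  have le: "absv (evalH (F j) z - evalH f z) \<le> M * absv z ^ j" for j
  proof -
    have "F j \<in> carrier Hinf" "f \<in> carrier Hinf" using F f carrier_Hinf_iff by blast+
    then have "evalH (F j) z - evalH f z = evalH (F j - f) z"
      by (rule evalH_diff[OF _ _ z, symmetric])
    also have "absv \<dots> \<le> M * absv z ^ j"
      by (intro absv_evalH_le_tail coeff_le_diff F f z) (simp add: agree)
    finally show ?thesis .
  qed
  have lim: "(\<lambda>j. M * absv z ^ j) \<longlonglongrightarrow> 0"
    using tendsto_mult_right_zero[OF LIMSEQ_realpow_zero[OF absv_nonneg z]] .
  have "(\<lambda>j. absv (evalH (F j) z - evalH f z)) \<longlonglongrightarrow> 0"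
    by (rule tendsto_sandwich[OF _ _ tendsto_const lim]) (use le in auto)
  then show ?thesis by (rule tendsto_iff_absv[THEN iffD2])
qed

definition truncate :: "nat \<Rightarrow> 'a::zero fps \<Rightarrow> 'a poly" where
  "truncate j f = Poly (map (fps_nth f) [0..<Suc j])"

lemma coeff_truncate: "coeff (truncate j f) i = (if i \<le> j then f $ i else 0)"
  by (auto simp: truncate_def nth_default_def simp del: upt_Suc)

text \<open>
  Multiplicativity holds for polynomials, and the products of the truncations stabilize to the
  product of the series.
\<close>

lemma evalH_mult:
  assumes f: "f \<in> carrier Hinf" and g: "g \<in> carrier Hinf" and z: "absv z < 1"
  shows "evalH (f * g) z = evalH f z * evalH g z"
proof -
  obtain M N where M: "coeff_le M f" and N: "coeff_le N g"
    using f g carrier_Hinf_iff by blast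
  let ?t = "\<lambda>h j. fps_of_poly (truncate j h)"
  have tr: "coeff_le M (?t h j)" if "coeff_le M h" for M j and h :: "'a fps"
    using that coeff_le_nonneg[OF that] by (auto simp: coeff_le_def coeff_truncate)
  have "(\<lambda>j. evalH (?t f j * ?t g j) z) \<longlonglongrightarrow> evalH (f * g) z"
  proof (rule evalH_tendsto[OF _ _ z])
    show "coeff_le (M * N) (?t f j * ?t g j)" for j
      by (intro coeff_le_mult tr M N)
    show "(?t f j * ?t g j) $ i = (f * g) $ i" if "i \<le> j" for i j
      unfolding fps_mult_nth using that by (intro sum.cong) (auto simp: coeff_truncate)
  qed
  moreover have "evalH (?t f j * ?t g j) z = evalH (?t f j) z * evalH (?t g j) z" for j
    by (simp only: evalH_fps_of_poly fps_of_poly_mult[symmetric] poly_mult)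
  moreover have "(\<lambda>j. evalH (?t f j) z * evalH (?t g j) z) \<longlonglongrightarrow> evalH f z * evalH g z"
    by (intro tendsto_mult evalH_tendsto[OF tr[OF M] _ z] evalH_tendsto[OF tr[OF N] _ z])
      (simp_all add: coeff_truncate)
  ultimately show ?thesis by (simp only: LIMSEQ_unique)
qed

lemma evalH_power:
  assumes "f \<in> carrier Hinf" "absv z < 1"
  shows "f ^ n \<in> carrier Hinf \<and> evalH (f ^ n) z = evalH f z ^ n"
  using assms by (induction n) (auto simp: evalH_mult)

lemma evalH_prod:
  assumes "\<And>i. i \<in> A \<Longrightarrow> f i \<in> carrier Hinf" "absv z < 1"
  shows "evalH (\<Prod>i\<in>A. f i) z = (\<Prod>i\<in>A. evalH (f i) z)"
  using assms by (induction A rule: infinite_finite_induct) (auto simp: evalH_mult)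

lemma evalH_sum:
  assumes "\<And>i. i \<in> A \<Longrightarrow> f i \<in> carrier Hinf" "absv z < 1"
  shows "evalH (\<Sum>i\<in>A. f i) z = (\<Sum>i\<in>A. evalH (f i) z)"
  using assms by (induction A rule: infinite_finite_induct) (auto simp: evalH_add)

text \<open>
  In the ultrametric setting each \<open>x\<^sup>n - y\<^sup>n\<close> has absolute value at most \<open>|x - y|\<close>, so the Lipschitz
  constant is the norm itself.
\<close>

lemma absv_evalH_diff_le:
  assumes M: "coeff_le M f" and x: "absv x < 1" and y: "absv y < 1"
  shows "absv (evalH f x - evalH f y) \<le> M * absv (x - y)"
proof -
  have M0: "0 \<le> M" using coeff_le_nonneg[OF M] .
  have f: "f \<in> carrier Hinf" using M carrier_Hinf_iff by blast
  have pow: "absv (x ^ n - y ^ n) \<le> absv (x - y)" for n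
  proof -
    have "absv (\<Sum>i<n. y ^ (n - Suc i) * x ^ i) \<le> 1"
    proof (rule absv_sum_le)
      show "absv (y ^ (n - Suc i) * x ^ i) \<le> 1" for i
        unfolding absv_mult absv_power
        using x y by (intro mult_le_one power_le_one zero_le_power absv_nonneg) auto
    qed simp
    then show ?thesis
      unfolding power_diff_sumr2 absv_mult by (intro mult_left_le) auto
  qed
  have "(\<lambda>n. (\<Sum>i<n. f $ i * x ^ i) - (\<Sum>i<n. f $ i * y ^ i)) \<longlonglongrightarrow> evalH f x - evalH f y"
    using evalH_sums[OF f x] evalH_sums[OF f y] unfolding sums_def by (rule tendsto_diff)
  then have "(\<lambda>n. absv (\<Sum>i<n. f $ i * (x ^ i - y ^ i))) \<longlonglongrightarrow> absv (evalH f x - evalH f y)"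
    unfolding right_diff_distrib sum_subtractf by (rule tendsto_absv)
  moreover have "absv (\<Sum>i<n. f $ i * (x ^ i - y ^ i)) \<le> M * absv (x - y)" for n
    using M0 coeff_leD[OF M] pow
    by (intro absv_sum_le) (simp_all only: absv_mult mult_mono absv_nonneg mult_nonneg_nonneg)
  ultimately show ?thesis using Lim_bounded by blast
qed

section \<open>Slowly growing weights\<close>

lemma finite_large_values_if_bounded_sums:
  fixes g :: "'b \<Rightarrow> real"
  assumes bd: "\<And>F. finite F \<Longrightarrow> F \<subseteq> S \<Longrightarrow> sum g F \<le> L" and c: "0 < c"
  shows "finite {w \<in> S. c \<le> g w}"
proof (rule ccontr)
  assume inf: "infinite {w \<in> S. c \<le> g w}"
  obtain n :: nat where n: "L / c < real n" using reals_Archimedean2 by blast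
  obtain F where F: "finite F" "card F = n" "F \<subseteq> {w \<in> S. c \<le> g w}"
    using infinite_arbitrarily_large[OF inf] by blast
  have "real n * c \<le> sum g F"
    using F sum_bounded_below[of F c g] by auto
  also have "\<dots> \<le> L" using F by (intro bd) auto
  finally show False using n c by (simp add: field_simps)
qed

text \<open>
  A convergent positive series stays convergent after multiplication with suitable weights tending to
  infinity. Choose an exhaustion of \<open>S\<close> by finite sets \<open>H 0 \<subseteq> H 1 \<subseteq> \<dots>\<close> such that the sum outside \<open>H j\<close>
  is at most \<open>2\<^bsup>-j\<^esup>\<close>, and let \<open>N w - 1\<close> count the sets \<open>H j\<close> that miss \<open>w\<close>. The weighted sum is
  then the original one plus the sum of all these tails.
\<close>

lemma ex_unbounded_weights_with_bounded_sums:
  fixes g :: "'b \<Rightarrow> real"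
  assumes bd: "\<And>F. finite F \<Longrightarrow> F \<subseteq> S \<Longrightarrow> sum g F \<le> L" and pos: "\<And>w. w \<in> S \<Longrightarrow> 0 < g w"
  shows "\<exists>N B. (\<forall>w. 1 \<le> N w) \<and> (\<forall>i. finite {w \<in> S. N w \<le> i}) \<and>
    (\<forall>F. finite F \<longrightarrow> F \<subseteq> S \<longrightarrow> (\<Sum>w\<in>F. real (N w) * g w) \<le> B)"
proof -
  define s where "s = (SUP F\<in>{F. finite F \<and> F \<subseteq> S}. sum g F)"
  have bdd: "bdd_above (sum g ` {F. finite F \<and> F \<subseteq> S})"
    using bd by (auto simp: bdd_above_def)
  have le_s: "sum g F \<le> s" if "finite F" "F \<subseteq> S" for F
    unfolding s_def using that bdd by (intro cSUP_upper) auto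
  have "\<exists>F. finite F \<and> F \<subseteq> S \<and> s - (1/2) ^ j < sum g F" for j :: nat
  proof -
    have "s - (1/2) ^ j < s" by simp
    then show ?thesis
      unfolding s_def using bdd by (subst (asm) less_cSUP_iff) auto
  qed
  then obtain P where P: "\<And>j. finite (P j)" "\<And>j. P j \<subseteq> S" "\<And>j. s - (1/2) ^ j < sum g (P j)"
    by metis
  define E where "E j = {w \<in> S. 1 / real (Suc j) \<le> g w}" for j
  have E: "finite (E j)" for j
    unfolding E_def using bd by (intro finite_large_values_if_bounded_sums) auto
  define H where "H j = (\<Union>i\<le>j. P i \<union> E i)" for j
  have H: "finite (H j)" "H j \<subseteq> S" "P j \<subseteq> H j" for j
    using P E by (auto simp: H_def E_def)
  have H_mono: "H i \<subseteq> H j" if "i \<le> j" for i j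
    using that by (force simp: H_def)
  have H_ex: "\<exists>j. w \<in> H j" if "w \<in> S" for w
  proof -
    obtain j where "inverse (real (Suc j)) < g w" using reals_Archimedean pos[OF \<open>w \<in> S\<close>] by blast
    then have "w \<in> E j" using that by (simp add: E_def inverse_eq_divide)
    then show ?thesis by (auto simp: H_def)
  qed
  have tail: "sum g (F - H j) \<le> (1/2) ^ j" if "finite F" "F \<subseteq> S" for F j
  proof -
    have "sum g (F - H j) + sum g (P j) \<le> sum g (F - H j) + sum g (H j)"
      using H P pos by (intro add_left_mono sum_mono2) (auto simp: less_imp_le subset_iff)
    also have "\<dots> = sum g ((F - H j) \<union> H j)"
      using that H by (intro sum.union_disjoint[symmetric]) auto
    also have "\<dots> \<le> s" using that H by (intro le_s) auto
    finally show ?thesis using P(3)[of j] by linarith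
  qed
  define N where "N w = Suc (card {j. w \<notin> H j})" for w
  have subset: "{j. w \<notin> H j} \<subseteq> {..<j}" if "w \<in> H j" for w j
  proof
    fix i assume "i \<in> {j. w \<notin> H j}"
    then have "\<not> j \<le> i" using H_mono[of j i] that by blast
    then show "i \<in> {..<j}" by simp
  qed
  have fin: "finite {w \<in> S. N w \<le> i}" for i
  proof (rule finite_subset[OF _ H(1)])
    show "{w \<in> S. N w \<le> i} \<subseteq> H i"
    proof
      fix w assume w: "w \<in> {w \<in> S. N w \<le> i}"
      show "w \<in> H i"
      proof (rule ccontr)
        assume "w \<notin> H i"
        then have "{..i} \<subseteq> {j. w \<notin> H j}" using H_mono by blast
        moreover obtain k where "w \<in> H k" using w H_ex by blast
        then have "finite {j. w \<notin> H j}" by (rule finite_subset[OF subset]) simp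
        ultimately have "card {..i} \<le> card {j. w \<notin> H j}" by (intro card_mono)
        then show False using w by (simp add: N_def)
      qed
    qed
  qed
  have "(\<Sum>w\<in>F. real (N w) * g w) \<le> s + 2" if F: "finite F" "F \<subseteq> S" for F
  proof -
    have "\<exists>K. F \<subseteq> H K" using F
    proof (induction F)
      case (insert x F)
      then obtain K where "F \<subseteq> H K" by blast
      moreover obtain j where "x \<in> H j" using H_ex[of x] insert.prems by blast
      ultimately have "insert x F \<subseteq> H (max K j)" using H_mono[of K "max K j"] H_mono[of j "max K j"] by auto
      then show ?case ..
    qed auto
    then obtain K where K: "F \<subseteq> H K" ..
    have N: "real (N w) = 1 + (\<Sum>j<K. of_bool (w \<notin> H j))" if "w \<in> F" for w
    proof -
      have "{j. w \<notin> H j} = {..<K} \<inter> {j. w \<notin> H j}" using subset K that by blast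
      then show ?thesis unfolding N_def by (simp add: sum_of_bool_eq)
    qed
    have "(\<Sum>w\<in>F. real (N w) * g w) = (\<Sum>w\<in>F. g w + (\<Sum>j<K. of_bool (w \<notin> H j) * g w))"
      by (intro sum.cong refl) (simp add: N algebra_simps sum_distrib_left)
    also have "\<dots> = sum g F + (\<Sum>j<K. \<Sum>w\<in>F. of_bool (w \<notin> H j) * g w)"
      by (subst sum.swap) (simp add: sum.distrib)
    also have "(\<Sum>j<K. \<Sum>w\<in>F. of_bool (w \<notin> H j) * g w) = (\<Sum>j<K. sum g (F - H j))"
      using F(1) by (simp add: sum_of_bool_mult_eq Diff_eq Collect_neg_eq)
    also have "\<dots> \<le> (\<Sum>j<K. (1/2) ^ j)" by (intro sum_mono tail F)
    also have "\<dots> \<le> 2" by (simp add: sum_gp_strict)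
    finally show ?thesis using le_s[OF F] by linarith
  qed
  then show ?thesis using fin by (intro exI[of _ N] exI[of _ "s + 2"]) (simp add: N_def)
qed

section \<open>Interpolation on separated sets\<close>

text \<open>
  Finite products suffice: in the unit disk the factors are below \<open>1\<close>, so the infinite product is the
  infimum of the finite ones.
\<close>

definition separated :: "real \<Rightarrow> 'a::nonarch_field set \<Rightarrow> bool" where
  "separated d S \<longleftrightarrow> (\<forall>w\<in>S. \<forall>F. finite F \<longrightarrow> F \<subseteq> S - {w} \<longrightarrow> d \<le> (\<Prod>v\<in>F. absv (w - v)))"

lemma separated_sum_ln_le:
  assumes "separated d S" "0 < d" "w \<in> S" "finite F" "F \<subseteq> S - {w}"
  shows "(\<Sum>v\<in>F. - ln (absv (w - v))) \<le> - ln d"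
proof -
  have "d \<le> (\<Prod>v\<in>F. absv (w - v))" using assms by (auto simp: separated_def)
  then have "ln d \<le> ln (\<Prod>v\<in>F. absv (w - v))" using assms(2) by (subst ln_le_cancel_iff) linarith+
  also have "\<dots> = (\<Sum>v\<in>F. ln (absv (w - v)))" using assms by (intro ln_prod) auto
  finally show ?thesis by (simp add: sum_negf)
qed

lemma minus_ln_absv_pos: "v \<in> unit_disk \<Longrightarrow> v \<noteq> 0 \<Longrightarrow> 0 < - ln (absv v)"
  by (auto simp: unit_disk_def ln_less_zero)

lemma unit_disk_diff: "v \<in> unit_disk \<Longrightarrow> w \<in> unit_disk \<Longrightarrow> v - w \<in> unit_disk"
  using absv_diff_le[of v w] by (auto simp: unit_disk_def)

text \<open>
  Compare with the products at one fixed point \<open>w\<close> of \<open>S\<close>: wherever \<open>|v| > |w|\<close> the factor \<open>|w - v|\<close>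
  equals \<open>|v|\<close>. Only finitely many points \<open>v\<close> are left over, since \<open>|v| \<le> |w|\<close> forces \<open>|w - v| \<le> |w| < 1\<close>.
\<close>

lemma separated_bounded_sum_ln:
  assumes S: "S \<subseteq> unit_disk" and sep: "separated d S" and d: "0 < d"
  shows "\<exists>L. \<forall>F. finite F \<longrightarrow> F \<subseteq> S - {0} \<longrightarrow> (\<Sum>v\<in>F. - ln (absv v)) \<le> L"
proof (cases "S = {}")
  case False
  then obtain w where w: "w \<in> S" by blast
  define A where "A = {v \<in> S - {w}. absv v \<le> absv w}"
  have "finite A"
  proof (cases "w = 0")
    case False
    have "finite {v \<in> S - {w}. - ln (absv w) \<le> - ln (absv (w - v))}"
      using separated_sum_ln_le[OF sep d w] minus_ln_absv_pos[of w] S w False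
      by (intro finite_large_values_if_bounded_sums) blast+
    moreover have "A \<subseteq> {v \<in> S - {w}. - ln (absv w) \<le> - ln (absv (w - v))}"
    proof
      fix v assume v: "v \<in> A"
      then have "0 < absv (w - v)" "absv (w - v) \<le> absv w"
        using absv_diff_le[of w v] by (auto simp: A_def)
      then have "ln (absv (w - v)) \<le> ln (absv w)" by (subst ln_le_cancel_iff) linarith+
      then show "v \<in> {v \<in> S - {w}. - ln (absv w) \<le> - ln (absv (w - v))}"
        using v by (simp add: A_def)
    qed
    ultimately show ?thesis by (rule rev_finite_subset)
  qed (simp add: A_def)
  define A' where "A' = insert w A - {0}"
  have A': "finite A'" "A' \<subseteq> S - {0}" using \<open>finite A\<close> w by (auto simp: A'_def A_def)
  have nn: "0 \<le> - ln (absv v)" if "v \<in> S - {0}" for v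
    using minus_ln_absv_pos[of v] that S by fastforce
  have "(\<Sum>v\<in>F. - ln (absv v)) \<le> (\<Sum>v\<in>A'. - ln (absv v)) + (- ln d)"
    if F: "finite F" "F \<subseteq> S - {0}" for F
  proof -
    have eq: "absv (w - v) = absv v" if "v \<in> F - A'" for v
      using that F absv_diff_eq_right[of w v] by (auto simp: A'_def A_def)
    have "(\<Sum>v\<in>F. - ln (absv v)) = (\<Sum>v\<in>F \<inter> A'. - ln (absv v)) + (\<Sum>v\<in>F - A'. - ln (absv v))"
      using sum.Int_Diff[OF F(1)] .
    also have "(\<Sum>v\<in>F \<inter> A'. - ln (absv v)) \<le> (\<Sum>v\<in>A'. - ln (absv v))"
    proof (rule sum_mono2)
      show "0 \<le> - ln (absv v)" if "v \<in> A' - F \<inter> A'" for v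
        using that A' by (intro nn) blast
    qed (use A' in auto)
    also have "(\<Sum>v\<in>F - A'. - ln (absv v)) = (\<Sum>v\<in>F - A'. - ln (absv (w - v)))"
      using eq by (intro sum.cong) auto
    also have "\<dots> \<le> - ln d"
      using F by (intro separated_sum_ln_le[OF sep d w]) (auto simp: A'_def)
    finally show ?thesis by simp
  qed
  then show ?thesis by blast
qed auto


lemma fps_mult_agree_if_agree_1:
  fixes f g :: "'a::comm_ring_1 fps"
  assumes "\<And>l. l \<le> i \<Longrightarrow> g $ l = 1 $ l" "l \<le> i"
  shows "(f * g) $ l = f $ l"
proof -
  have "(f * g) $ l = (f * 1) $ l"
    unfolding fps_mult_nth using assms by (intro sum.cong refl) auto
  then show ?thesis by simp
qed

lemma fps_prod_agree_1:
  fixes g :: "'b \<Rightarrow> 'a::comm_ring_1 fps"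
  assumes "\<And>m l. m \<in> A \<Longrightarrow> l \<le> i \<Longrightarrow> g m $ l = 1 $ l" "l \<le> i"
  shows "(\<Prod>m\<in>A. g m) $ l = 1 $ l"
  using assms
proof (induction A arbitrary: l rule: infinite_finite_induct)
  case (insert m A)
  have "(g m * (\<Prod>m\<in>A. g m)) $ l = g m $ l"
    using insert by (intro fps_mult_agree_if_agree_1[of i]) auto
  with insert show ?case by simp
qed auto

text \<open>
  The substitute for a Blaschke product is \<open>B = \<Prod>(1 - (z/m)\<^bsup>N m\<^esup>)\<close>. All zeros of the factor at \<open>m\<close> have
  absolute value \<open>|m|\<close>; so \<open>B\<close> may have zeros besides \<open>T\<close>, but none closer to the origin than all of
  \<open>T\<close>, and there \<open>|B| = 1\<close>.
\<close>

lemma ex_bounded_function_vanishing_on: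
  fixes T :: "'a::nonarch_field set"
  assumes T: "T \<subseteq> unit_disk - {0}" and N1: "\<And>m. 1 \<le> N m"
    and fin: "\<And>i. finite {m \<in> T. N m \<le> i}"
    and M: "\<And>F. finite F \<Longrightarrow> F \<subseteq> T \<Longrightarrow> (\<Prod>m\<in>F. inverse (absv m) ^ N m) \<le> M"
  shows "\<exists>B. coeff_le M B \<and> (\<forall>m\<in>T. evalH B m = 0) \<and>
    (\<forall>z\<in>unit_disk. (\<forall>m\<in>T. absv z < absv m) \<longrightarrow> absv (evalH B z) = 1)"
proof -
  define G where "G m = 1 - fps_const (inverse m ^ N m) * fps_X ^ N m" for m :: 'a
  have G_nth: "G m $ l = (if l = 0 then 1 else if l = N m then - (inverse m ^ N m) else 0)" for m l
    using N1[of m] by (auto simp: G_def fps_X_power_nth)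
  have G_carrier: "G m \<in> carrier Hinf" for m unfolding G_def by simp
  have evalG: "evalH (G m) z = 1 - (z / m) ^ N m" if "z \<in> unit_disk" for m z
    using that evalH_power[of fps_X z "N m"]
    by (simp add: G_def unit_disk_def evalH_diff evalH_mult divide_inverse power_mult_distrib mult.commute)
  have coeffG: "coeff_le (inverse (absv m) ^ N m) (G m)" if "m \<in> T" for m
  proof -
    have "1 \<le> inverse (absv m)" using that T by (force simp: unit_disk_def one_le_inverse_iff)
    then have "1 \<le> inverse (absv m) ^ N m" by (rule one_le_power)
    then show ?thesis
      by (simp add: coeff_le_def G_nth absv_power absv_inverse)
  qed
  define P where "P j = (\<Prod>m\<in>{m \<in> T. N m \<le> j}. G m)" for j
  define B where "B = Abs_fps (\<lambda>i. P i $ i)"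
  have bound: "coeff_le M (P j)" for j
  proof (rule coeff_le_mono)
    show "coeff_le (\<Prod>m\<in>{m \<in> T. N m \<le> j}. inverse (absv m) ^ N m) (P j)"
      unfolding P_def using coeffG by (intro coeff_le_prod) auto
  qed (use fin in \<open>auto intro: M\<close>)
  have agree: "P j $ i = B $ i" if "i \<le> j" for i j
  proof -
    let ?D = "{m \<in> T. N m \<le> j} - {m \<in> T. N m \<le> i}"
    have "P j = P i * (\<Prod>m\<in>?D. G m)"
      unfolding P_def using that fin[of j]
      by (subst prod.subset_diff[of "{m \<in> T. N m \<le> i}"]) (auto simp: mult.commute)
    moreover have "(P i * (\<Prod>m\<in>?D. G m)) $ i = P i $ i"
      by (rule fps_mult_agree_if_agree_1[OF fps_prod_agree_1]) (auto simp: G_nth)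
    ultimately show ?thesis by (simp add: B_def)
  qed
  have lim: "(\<lambda>j. evalH (P j) z) \<longlonglongrightarrow> evalH B z" if "z \<in> unit_disk" for z
    using evalH_tendsto[OF bound agree] that by (simp add: unit_disk_def)
  have evalP: "evalH (P j) z = (\<Prod>m\<in>{m \<in> T. N m \<le> j}. 1 - (z / m) ^ N m)" if "z \<in> unit_disk" for j z
    using that evalG G_carrier by (simp add: P_def evalH_prod unit_disk_def)
  have "evalH B m = 0" if m: "m \<in> T" for m
  proof -
    have md: "m \<in> unit_disk" "m \<noteq> 0" using m T by auto
    have "evalH (P j) m = 0" if "N m \<le> j" for j
      unfolding evalP[OF md(1)] using m md fin[of j] that by (intro prod_zero) auto
    then have "\<forall>\<^sub>F j in sequentially. evalH (P j) m = 0"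
      unfolding eventually_sequentially by blast
    then have "(\<lambda>j. evalH (P j) m) \<longlonglongrightarrow> 0" by (rule tendsto_eventually)
    with lim[OF md(1)] show ?thesis by (rule LIMSEQ_unique)
  qed
  moreover have "absv (evalH B z) = 1" if z: "z \<in> unit_disk" "\<And>m. m \<in> T \<Longrightarrow> absv z < absv m" for z
  proof -
    have "absv (1 - (z / m) ^ N m) = 1" if "m \<in> T" for m
    proof -
      have "absv z / absv m < 1" using z(2)[OF that] by (simp add: divide_less_eq_1)
      then have "(absv z / absv m) ^ N m < 1"
        using N1[of m] by (intro power_less_one_iff[THEN iffD2]) auto
      then show ?thesis
        using absv_diff_eq_right[of "(z / m) ^ N m" 1]
        by (simp add: absv_power absv_divide absv_minus_commute[of 1])
    qed
    then have "absv (evalH (P j) z) = 1" for j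
      unfolding evalP[OF z(1)] absv_prod by (intro prod.neutral) auto
    with tendsto_absv[OF lim[OF z(1)]] have "(\<lambda>j. 1) \<longlonglongrightarrow> absv (evalH B z)" by simp
    then show ?thesis by (simp add: LIMSEQ_const_iff)
  qed
  moreover have "coeff_le M B"
    using coeff_leD[OF bound] by (simp add: coeff_le_def B_def)
  ultimately show ?thesis by blast
qed

text \<open>
  Since \<open>e n\<close> is divisible by \<open>z\<^bsup>N n\<^esup>\<close>, the sum of all \<open>a n * e n\<close> is a finite one in every coefficient.
\<close>

lemma ex_combination_of_interpolation_basis:
  fixes e :: "'a::nonarch_field \<Rightarrow> 'a fps"
  assumes S: "S \<subseteq> unit_disk" and fin: "\<And>i. finite {n \<in> S. N n \<le> i}"
    and e: "\<And>n. n \<in> S \<Longrightarrow> coeff_le C (e n)"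
    and low: "\<And>n i. n \<in> S \<Longrightarrow> i < N n \<Longrightarrow> e n $ i = 0"
    and val: "\<And>n m. n \<in> S \<Longrightarrow> m \<in> S \<Longrightarrow> evalH (e n) m = of_bool (m = n)"
    and a: "\<And>n. n \<in> S \<Longrightarrow> absv (a n) \<le> K" and "0 \<le> C" "0 \<le> K"
  shows "\<exists>f \<in> carrier Hinf. \<forall>w\<in>S. evalH f w = a w"
proof -
  define P where "P j = (\<Sum>n\<in>{n \<in> S. N n \<le> j}. fps_const (a n) * e n)" for j
  define f where "f = Abs_fps (\<lambda>i. P i $ i)"
  have bound: "coeff_le (K * C) (P j)" for j
    unfolding P_def
    using assms by (intro coeff_le_sum coeff_le_mult coeff_le_mono[OF coeff_le_const]) auto
  have agree: "P j $ i = f $ i" if "i \<le> j" for i j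
  proof -
    have "(\<Sum>n\<in>{n \<in> S. N n \<le> j}. (fps_const (a n) * e n) $ i) =
        (\<Sum>n\<in>{n \<in> S. N n \<le> i}. (fps_const (a n) * e n) $ i)"
      using that fin[of j] low by (intro sum.mono_neutral_right) (auto simp: not_le)
    then show ?thesis by (simp add: f_def P_def fps_sum_nth)
  qed
  have "evalH f w = a w" if w: "w \<in> S" for w
  proof -
    have wd: "absv w < 1" using w S by (auto simp: unit_disk_def)
    have ec: "e n \<in> carrier Hinf" if "n \<in> S" for n using e[OF that] carrier_Hinf_iff by blast
    have "evalH (P j) w = a w" if "N w \<le> j" for j
    proof -
      have "evalH (P j) w = (\<Sum>n\<in>{n \<in> S. N n \<le> j}. a n * evalH (e n) w)"
        unfolding P_def using ec wd by (subst evalH_sum) (auto simp: evalH_mult)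
      also have "\<dots> = (\<Sum>n\<in>{n \<in> S. N n \<le> j}. if w = n then a n else 0)"
        using w by (intro sum.cong) (auto simp: val)
      also have "\<dots> = a w" using fin[of j] w that by simp
      finally show ?thesis .
    qed
    then have "\<forall>\<^sub>F j in sequentially. evalH (P j) w = a w"
      unfolding eventually_sequentially by blast
    then have "(\<lambda>j. evalH (P j) w) \<longlonglongrightarrow> a w" by (rule tendsto_eventually)
    with evalH_tendsto[OF bound agree wd] show ?thesis by (rule LIMSEQ_unique)
  qed
  moreover have "coeff_le (K * C) f"
    using coeff_leD[OF bound] by (simp add: coeff_le_def f_def)
  ultimately show ?thesis using carrier_Hinf_iff by blast
qed

text \<open>
  The proof supplies the basis \<open>e n\<close> of the preceding lemma. Separation bounds the norm of the Lagrange
  factors by \<open>1/d\<close>, uniformly in \<open>n\<close>; the choice of the weights bounds that of \<open>(z/n)\<^bsup>N n\<^esup>\<close> and that of the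
  product over the points beyond \<open>n\<close> by \<open>M\<close>.
\<close>

theorem interpolation_on_separated_set:
  fixes S :: "'a::nonarch_field set"
  assumes S: "S \<subseteq> unit_disk" and sep: "separated d S" and d: "0 < d"
    and a: "\<And>w. w \<in> S \<Longrightarrow> absv (a w) \<le> K"
  shows "\<exists>f \<in> carrier Hinf. \<forall>w\<in>S. evalH f w = a w"
proof (cases "S = {}")
  case True
  then show ?thesis using Hinf_0 by blast
next
  case False
  let ?g = "\<lambda>v::'a. - ln (absv v)"
  obtain L where L: "\<And>F. finite F \<Longrightarrow> F \<subseteq> S - {0} \<Longrightarrow> sum ?g F \<le> L"
    using separated_bounded_sum_ln[OF S sep d] by blast
  have gpos: "0 < ?g v" if "v \<in> S - {0}" for v using that S minus_ln_absv_pos[of v] by blast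
  from ex_unbounded_weights_with_bounded_sums[of "S - {0}" ?g L, OF L gpos]
  obtain N b where "\<forall>w. 1 \<le> N w" "\<forall>i. finite {w \<in> S - {0}. N w \<le> i}"
    "\<forall>F. finite F \<longrightarrow> F \<subseteq> S - {0} \<longrightarrow> (\<Sum>w\<in>F. real (N w) * ?g w) \<le> b"
    by blast
  then have N1: "\<And>w. 1 \<le> N w" and finN: "\<And>i. finite {w \<in> S - {0}. N w \<le> i}"
    and b: "\<And>F. finite F \<Longrightarrow> F \<subseteq> S - {0} \<Longrightarrow> (\<Sum>w\<in>F. real (N w) * ?g w) \<le> b"
    by blast+
  define M where "M = exp b"
  have M: "(\<Prod>m\<in>F. inverse (absv m) ^ N m) \<le> M" if "finite F" "F \<subseteq> S - {0}" for F
  proof -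
    have "inverse (absv m) ^ N m = exp (real (N m) * ?g m)" if "m \<in> F" for m
    proof -
      have "0 < absv m" using that \<open>F \<subseteq> S - {0}\<close> by auto
      then have "exp (?g m) = inverse (absv m)" by (simp add: exp_minus)
      then show ?thesis unfolding exp_of_nat_mult by (rule arg_cong[symmetric])
    qed
    then have "(\<Prod>m\<in>F. inverse (absv m) ^ N m) = (\<Prod>m\<in>F. exp (real (N m) * ?g m))"
      by (intro prod.cong refl)
    also have "\<dots> = exp (\<Sum>m\<in>F. real (N m) * ?g m)"
      using exp_sum[OF \<open>finite F\<close>] by (rule sym)
    also have "\<dots> \<le> M" unfolding M_def using b[OF that] by (rule iffD2[OF exp_le_cancel_iff])
    finally show ?thesis .
  qed
  have M1: "1 \<le> M" using M[of "{}"] by simp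
  \<comment> \<open>The origin may belong to S; it gets weight 0 so that (0/0)^0 = 1 in its basis function.\<close>
  define N0 where "N0 w = (if w = 0 then 0 else N w)" for w :: 'a
  have finN0: "finite {w \<in> S. N0 w \<le> i}" for i
  proof (rule finite_subset)
    show "{w \<in> S. N0 w \<le> i} \<subseteq> insert 0 {w \<in> S - {0}. N w \<le> i}" by (auto simp: N0_def)
  qed (use finN in auto)
  have inv_pow: "inverse (absv n) ^ N0 n \<le> M" if "n \<in> S" for n
    using M[of "{n}"] M1 that by (auto simp: N0_def)
  have "\<exists>e. coeff_le (M * M / d) e \<and> (\<forall>i<N0 n. e $ i = 0) \<and> (\<forall>m\<in>S. evalH e m = of_bool (m = n))"
    if n: "n \<in> S" for n
  proof -
    have nd: "n \<in> unit_disk" "absv n < 1" using n S by (auto simp: unit_disk_def)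
    define A where "A = {m \<in> S - {n}. absv m \<le> absv n}"
    define T where "T = {m \<in> S. absv n < absv m}"
    have TS: "T \<subseteq> S - {0}" by (auto simp: T_def)
    have finA: "finite A"
    proof (cases "n = 0")
      case False
      then have "finite {m \<in> S - {0}. ?g n \<le> ?g m}"
        using gpos[of n] n by (intro finite_large_values_if_bounded_sums[OF L]) blast+
      moreover have "A \<subseteq> insert 0 {m \<in> S - {0}. ?g n \<le> ?g m}"
      proof
        fix m assume m: "m \<in> A"
        show "m \<in> insert 0 {m \<in> S - {0}. ?g n \<le> ?g m}"
        proof (cases "m = 0")
          case m0: False
          then have "ln (absv m) \<le> ln (absv n)"
            using m False by (subst ln_le_cancel_iff) (auto simp: A_def)
          then show ?thesis using m m0 by (simp add: A_def)
        qed simp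
      qed
      ultimately show ?thesis by (meson finite_insert finite_subset)
    qed (auto simp: A_def)
    have "\<exists>B. coeff_le M B \<and> (\<forall>m\<in>T. evalH B m = 0) \<and>
      (\<forall>z\<in>unit_disk. (\<forall>m\<in>T. absv z < absv m) \<longrightarrow> absv (evalH B z) = 1)"
    proof (rule ex_bounded_function_vanishing_on[of T N M])
      show "finite {m \<in> T. N m \<le> i}" for i
        by (rule finite_subset[OF _ finN[of i]]) (use TS in auto)
    qed (use TS S N1 M in auto)
    then obtain B where B: "coeff_le M B" "\<And>m. m \<in> T \<Longrightarrow> evalH B m = 0"
      and Bn: "absv (evalH B n) = 1"
      using nd by (auto simp: T_def)
    have Bn0: "evalH B n \<noteq> 0" using Bn by auto
    define p where "p = (\<Prod>m\<in>A. fps_const (inverse (n - m)) * (fps_X - fps_const m))"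
    \<comment> \<open>Since B(n) has absolute value 1, dividing by it costs nothing in norm.\<close>
    define c where "c = inverse n ^ N0 n * inverse (evalH B n)"
    define e where "e = fps_X ^ N0 n * (fps_const c * (p * B))"
    have Bc: "B \<in> carrier Hinf" using B(1) carrier_Hinf_iff by blast
    have pc: "p \<in> carrier Hinf" by (simp add: p_def)
    have "coeff_le (1 * (M * (inverse d * M))) e"
      unfolding e_def
    proof (intro coeff_le_mult coeff_le_X_power B(1))
      have "absv c \<le> M" using inv_pow[OF n] Bn by (simp add: c_def absv_mult absv_power absv_inverse)
      then show "coeff_le M (fps_const c)" by (rule coeff_le_mono[OF coeff_le_const])
      have lin: "coeff_le 1 (fps_X - fps_const m)" if "m \<in> A" for m
      proof (rule coeff_le_diff)
        show "coeff_le 1 (fps_X :: 'a fps)" using coeff_le_X_power[of 1] by simp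
        have "absv m \<le> 1" using that nd by (auto simp: A_def)
        then show "coeff_le 1 (fps_const m)" by (rule coeff_le_mono[OF coeff_le_const])
      qed
      have "coeff_le (\<Prod>m\<in>A. absv (inverse (n - m)) * 1) p"
        unfolding p_def by (intro coeff_le_prod coeff_le_mult coeff_le_const lin)
      moreover have "(\<Prod>m\<in>A. absv (inverse (n - m)) * 1) \<le> inverse d"
      proof -
        have "d \<le> (\<Prod>m\<in>A. absv (n - m))"
          using sep n finA by (auto simp: separated_def A_def)
        then have "inverse (\<Prod>m\<in>A. absv (n - m)) \<le> inverse d"
          using d by (rule le_imp_inverse_le)
        moreover have "(\<Prod>m\<in>A. absv (inverse (n - m)) * 1) = inverse (\<Prod>m\<in>A. absv (n - m))"
          using prod_inversef[of "\<lambda>m. absv (n - m)" A] by (simp add: o_def absv_inverse)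
        ultimately show ?thesis by simp
      qed
      ultimately show "coeff_le (inverse d) p" by (rule coeff_le_mono)
    qed
    also have "1 * (M * (inverse d * M)) = M * M / d" by (simp add: divide_inverse)
    finally have "coeff_le (M * M / d) e" .
    moreover have "\<forall>i<N0 n. e $ i = 0" by (simp add: e_def fps_X_power_mult_nth)
    moreover have "evalH e m = of_bool (m = n)" if m: "m \<in> S" for m
    proof -
      have md: "absv m < 1" using m S by (auto simp: unit_disk_def)
      have p: "evalH p m = (\<Prod>v\<in>A. (m - v) / (n - v))"
        using md by (simp add: p_def evalH_prod evalH_mult evalH_diff divide_inverse mult.commute)
      have "evalH e m = m ^ N0 n * (c * (evalH p m * evalH B m))"
        using md Bc pc evalH_power[of fps_X m "N0 n"] by (simp add: e_def evalH_mult)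
      moreover consider "m = n" | "m \<in> A" | "m \<in> T"
        using m unfolding A_def T_def by (cases "absv m \<le> absv n") auto
      then have "m ^ N0 n * (c * (evalH p m * evalH B m)) = of_bool (m = n)"
      proof cases
        case 1
        have "evalH p n = 1" unfolding p[unfolded 1] by (intro prod.neutral) (auto simp: A_def)
        moreover have "n ^ N0 n * inverse n ^ N0 n = 1"
          by (simp add: N0_def flip: power_mult_distrib)
        moreover have "n ^ N0 n * (c * (1 * evalH B n)) =
            (n ^ N0 n * inverse n ^ N0 n) * (inverse (evalH B n) * evalH B n)"
          by (simp only: c_def mult_1_left mult.assoc)
        ultimately show ?thesis using Bn0 by (simp add: 1)
      next
        case 2
        then have "evalH p m = 0" unfolding p using finA by (intro prod_zero) auto
        then show ?thesis using 2 by (auto simp: A_def)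
      next
        case 3
        then show ?thesis using B(2)[OF 3] by (auto simp: T_def)
      qed
      ultimately show ?thesis by simp
    qed
    ultimately show ?thesis by blast
  qed
  then have "\<exists>e. \<forall>n\<in>S. coeff_le (M * M / d) (e n) \<and> (\<forall>i<N0 n. e n $ i = 0) \<and>
      (\<forall>m\<in>S. evalH (e n) m = of_bool (m = n))"
    by (intro bchoice ballI)
  then obtain e where e: "\<And>n. n \<in> S \<Longrightarrow> coeff_le (M * M / d) (e n)"
    "\<And>n i. n \<in> S \<Longrightarrow> i < N0 n \<Longrightarrow> e n $ i = 0"
    "\<And>n m. n \<in> S \<Longrightarrow> m \<in> S \<Longrightarrow> evalH (e n) m = of_bool (m = n)"
    by blast
  obtain w where "w \<in> S" using False by blast
  then have K: "0 \<le> K" using order_trans[OF absv_nonneg a] by blast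
  have C: "0 \<le> M * M / d" using M1 d by simp
  show ?thesis
    by (rule ex_combination_of_interpolation_basis[OF S finN0, where C = "M * M / d" and K = K])
      (fact e(1) e(2) e(3) a C K)+
qed

section \<open>The kernel as a vanishing ideal\<close>

text \<open>
  The image of an ultrafilter has a cluster point in the compact interval, and for an ultrafilter
  every cluster point is a limit.
\<close>

lemma ultrafilter_tendsto_if_bounded:
  fixes h :: "'i \<Rightarrow> real"
  assumes U: "ultrafilter U" and h: "\<And>n. h n \<in> {a..b}"
  shows "\<exists>l. (h \<longlongrightarrow> l) U"
proof -
  have "filtermap h U \<noteq> bot" using U by (simp add: ultrafilter_def filtermap_bot_iff)
  moreover have "eventually (\<lambda>x. x \<in> {a..b}) (filtermap h U)"
    unfolding eventually_filtermap using h by (intro always_eventually allI)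
  ultimately obtain l where l: "inf (nhds l) (filtermap h U) \<noteq> bot"
    using compact_Icc[of a b] unfolding compact_filter by blast
  have "(h \<longlongrightarrow> l) U"
  proof (rule topological_tendstoI, rule ccontr)
    fix S assume S: "open S" "l \<in> S" and "\<not> (\<forall>\<^sub>F n in U. h n \<in> S)"
    then have "\<forall>\<^sub>F n in U. h n \<notin> S" using U unfolding ultrafilter_def by blast
    then have "\<forall>\<^sub>F x in filtermap h U. x \<notin> S" unfolding eventually_filtermap .
    moreover have "\<forall>\<^sub>F x in nhds l. x \<in> S" using S by (rule eventually_nhds_in_open)
    ultimately have "\<forall>\<^sub>F x in inf (nhds l) (filtermap h U). False"
      unfolding eventually_inf by blast
    with l show False by (simp add: trivial_limit_def)
  qed
  then show ?thesis ..
qed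

lemma tendsto_at_right_0_INF_if_mono:
  fixes \<phi> :: "real \<Rightarrow> real"
  assumes mono: "\<And>r s. 0 < r \<Longrightarrow> r \<le> s \<Longrightarrow> s < 1 \<Longrightarrow> \<phi> r \<le> \<phi> s"
    and nonneg: "\<And>r. 0 < r \<Longrightarrow> r < 1 \<Longrightarrow> 0 \<le> \<phi> r"
  shows "(\<phi> \<longlongrightarrow> (INF r\<in>{0<..<1}. \<phi> r)) (at_right 0)"
proof (rule order_tendstoI)
  have bdd: "bdd_below (\<phi> ` {0<..<1})" using nonneg by (intro bdd_belowI2[where m = 0]) auto
  fix a assume a: "a < (INF r\<in>{0<..<1}. \<phi> r)"
  have "a < \<phi> r" if "r \<in> {0<..<1}" for r
    using cINF_lower[OF bdd that] a by linarith
  then show "\<forall>\<^sub>F r in at_right 0. a < \<phi> r"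
    using eventually_at_right_real[of 0 1] by (auto elim: eventually_mono)
next
  have bdd: "bdd_below (\<phi> ` {0<..<1})" using nonneg by (intro bdd_belowI2[where m = 0]) auto
  fix a assume "(INF r\<in>{0<..<1}. \<phi> r) < a"
  then obtain s where s: "s \<in> {0<..<1}" "\<phi> s < a"
    using bdd by (subst (asm) cINF_less_iff) auto
  have "\<phi> r < a" if "r \<in> {0<..<s}" for r
    using mono[of r s] s that by auto
  then show "\<forall>\<^sub>F r in at_right 0. \<phi> r < a"
    using eventually_at_right_real[of 0 s] s by (auto elim: eventually_mono)
qed

lemma closed_disk_subset_unit_disk:
  assumes "c \<in> unit_disk" "r < 1"
  shows "closed_disk c r \<subseteq> unit_disk"
proof
  fix w assume "w \<in> closed_disk c r"
  then show "w \<in> unit_disk"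
    using assms absv_ultrametric[of "w - c" c] by (auto simp: closed_disk_def unit_disk_def)
qed

lemma center_in_closed_disk: "0 \<le> r \<Longrightarrow> c \<in> closed_disk c r"
  by (simp add: closed_disk_def)

lemma closed_disk_mono: "r \<le> s \<Longrightarrow> closed_disk c r \<subseteq> closed_disk c s"
  by (auto simp: closed_disk_def)

lemma root_mono: "r \<le> s \<Longrightarrow> root n r \<le> root n s"
  by (cases "n = 0") auto

lemma zeta_disk_le_iff:
  assumes f: "f \<in> carrier Hinf" and D: "D \<subseteq> unit_disk" "D \<noteq> {}"
  shows "zeta_disk D f \<le> c \<longleftrightarrow> (\<forall>w\<in>D. absv (evalH f w) \<le> c)"
proof -
  obtain M where M: "coeff_le M f" using f carrier_Hinf_iff by blast
  have "bdd_above ((\<lambda>w. absv (evalH f w)) ` D)"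
    by (rule bdd_aboveI2[where M = M]) (use absv_evalH_le[OF M] D in \<open>auto simp: unit_disk_def\<close>)
  then show ?thesis unfolding zeta_disk_def using D(2) by (rule cSUP_le_iff[rotated])
qed

abbreviation root_disk :: "(nat \<Rightarrow> 'a::nonarch_field) \<Rightarrow> (nat \<Rightarrow> nat) \<Rightarrow> real \<Rightarrow> nat \<Rightarrow> 'a set" where
  "root_disk z k r n \<equiv> closed_disk (z n) (root (k n) r)"

context
  fixes z :: "nat \<Rightarrow> 'a::nonarch_field" and U :: "nat filter" and k :: "nat \<Rightarrow> nat"
  assumes U: "ultrafilter U" and z: "\<And>n. z n \<in> unit_disk" and k: "\<And>n. 1 \<le> k n"
begin

lemma root_disk_props:
  assumes "0 < r" "r < 1"
  shows "root_disk z k r n \<subseteq> unit_disk" "root_disk z k r n \<noteq> {}"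
proof -
  have "root (k n) r < 1" "0 \<le> root (k n) r" using assms k[of n] by auto
  then show "root_disk z k r n \<subseteq> unit_disk" "root_disk z k r n \<noteq> {}"
    using closed_disk_subset_unit_disk[OF z] center_in_closed_disk by blast+
qed

lemma zeta_disk_nonneg:
  assumes "f \<in> carrier Hinf" "0 < r" "r < 1"
  shows "0 \<le> zeta_disk (root_disk z k r n) f"
proof -
  have "z n \<in> root_disk z k r n" using assms by (intro center_in_closed_disk real_root_ge_zero) auto
  then have "absv (evalH f (z n)) \<le> zeta_disk (root_disk z k r n) f"
    using zeta_disk_le_iff[OF assms(1) root_disk_props[OF assms(2,3)]] by blast
  then show ?thesis using absv_nonneg order_trans by blast
qed

lemma zeta_tendsto:
  assumes f: "f \<in> carrier Hinf" and r: "0 < r" "r < 1"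
  shows "((\<lambda>n. zeta_disk (root_disk z k r n) f) \<longlongrightarrow> zeta z U k r f) U"
proof -
  obtain M where M: "coeff_le M f" using f carrier_Hinf_iff by blast
  have "zeta_disk (root_disk z k r n) f \<in> {0..M}" for n
    using zeta_disk_nonneg[OF f r] zeta_disk_le_iff[OF f root_disk_props[OF r]] root_disk_props(1)[OF r, of n]
      absv_evalH_le[OF M] by (auto simp: unit_disk_def subset_iff)
  then obtain l where l: "((\<lambda>n. zeta_disk (root_disk z k r n) f) \<longlongrightarrow> l) U"
    using ultrafilter_tendsto_if_bounded[OF U, of "\<lambda>n. zeta_disk (root_disk z k r n) f"] by blast
  have "U \<noteq> bot" using U by (simp add: ultrafilter_def)
  from tendsto_Lim[OF this l] have "zeta z U k r f = l" by (simp only: zeta_def)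
  with l show ?thesis by (simp only:)
qed

lemma zeta_nonneg:
  assumes "f \<in> carrier Hinf" "0 < r" "r < 1"
  shows "0 \<le> zeta z U k r f"
  using U by (intro tendsto_lowerbound[OF zeta_tendsto[OF assms]] always_eventually allI zeta_disk_nonneg[OF assms])
    (simp add: ultrafilter_def)

lemma zeta_mono:
  assumes f: "f \<in> carrier Hinf" and r: "0 < r" "r \<le> s" "s < 1"
  shows "zeta z U k r f \<le> zeta z U k s f"
proof (rule tendsto_le[OF _ zeta_tendsto zeta_tendsto])
  have rs: "r < 1" "0 < s" using r by auto
  have "zeta_disk (root_disk z k r n) f \<le> zeta_disk (root_disk z k s n) f" for n
  proof -
    have "\<forall>w\<in>root_disk z k s n. absv (evalH f w) \<le> zeta_disk (root_disk z k s n) f"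
      using zeta_disk_le_iff[OF f root_disk_props[OF rs(2) r(3)]] by blast
    then show ?thesis
      using zeta_disk_le_iff[OF f root_disk_props[OF r(1) rs(1)]] closed_disk_mono[OF root_mono[OF r(2)]]
      by blast
  qed
  then show "\<forall>\<^sub>F n in U. zeta_disk (root_disk z k r n) f \<le> zeta_disk (root_disk z k s n) f" by simp
qed (use f r U in \<open>auto simp: ultrafilter_def\<close>)

lemma zeta0_eq_INF:
  assumes "f \<in> carrier Hinf"
  shows "zeta0 z U k f = (INF r\<in>{0<..<1}. zeta z U k r f)"
  unfolding zeta0_def
  by (rule tendsto_Lim[OF _ tendsto_at_right_0_INF_if_mono])
    (use zeta_mono[OF assms] zeta_nonneg[OF assms] in auto)

text \<open>
  The limits along \<open>U\<close> and \<open>r \<rightarrow> 0\<close> both exist, by boundedness and by monotonicity. So the seminorm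
  vanishes at \<open>f\<close> if and only if \<open>f\<close> is uniformly small on \<open>U\<close>-almost all disks once \<open>r\<close> is small.
\<close>

lemma zeta0_eq_0_iff:
  assumes f: "f \<in> carrier Hinf"
  shows "zeta0 z U k f = 0 \<longleftrightarrow>
    (\<forall>e>0. \<exists>r\<in>{0<..<1}. \<forall>\<^sub>F n in U. \<forall>w\<in>root_disk z k r n. absv (evalH f w) < e)" (is "_ \<longleftrightarrow> ?R")
proof -
  let ?I = "INF r\<in>{0<..<1}. zeta z U k r f"
  have bdd: "bdd_below ((\<lambda>r. zeta z U k r f) ` {0<..<1})"
    using zeta_nonneg[OF f] by (intro bdd_belowI2[where m = 0]) auto
  have I0: "0 \<le> ?I" using zeta_nonneg[OF f] by (intro cINF_greatest) auto
  have "?I = 0 \<longleftrightarrow> ?R"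
  proof
    assume I: "?I = 0"
    show ?R
    proof (intro allI impI)
      fix e :: real assume "0 < e"
      with I have "?I < e" by simp
      then obtain r where r: "r \<in> {0<..<1}" "zeta z U k r f < e"
        using bdd by (subst (asm) cINF_less_iff) auto
      then have rr: "0 < r" "r < 1" by auto
      have "\<forall>\<^sub>F n in U. zeta_disk (root_disk z k r n) f < e"
        using order_tendstoD(2)[OF zeta_tendsto[OF f rr] r(2)] .
      then have "\<forall>\<^sub>F n in U. \<forall>w\<in>root_disk z k r n. absv (evalH f w) < e"
      proof (rule eventually_mono)
        fix n assume "zeta_disk (root_disk z k r n) f < e"
        then show "\<forall>w\<in>root_disk z k r n. absv (evalH f w) < e"
          using zeta_disk_le_iff[OF f root_disk_props[OF rr, of n], of "zeta_disk (root_disk z k r n) f"]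
          by auto
      qed
      then show "\<exists>r\<in>{0<..<1}. \<forall>\<^sub>F n in U. \<forall>w\<in>root_disk z k r n. absv (evalH f w) < e"
        using r(1) by blast
    qed
  next
    assume R: ?R
    have "?I \<le> e" if "0 < e" for e
    proof -
      obtain r where r: "r \<in> {0<..<1}" "\<forall>\<^sub>F n in U. \<forall>w\<in>root_disk z k r n. absv (evalH f w) < e"
        using R \<open>0 < e\<close> by blast
      then have rr: "0 < r" "r < 1" by auto
      have "\<forall>\<^sub>F n in U. zeta_disk (root_disk z k r n) f \<le> e"
        using r(2) zeta_disk_le_iff[OF f root_disk_props[OF rr]]
        by (auto elim!: eventually_mono intro: less_imp_le)
      moreover have "U \<noteq> bot" using U by (simp add: ultrafilter_def)
      ultimately have "zeta z U k r f \<le> e"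
        by (intro tendsto_upperbound[OF zeta_tendsto[OF f rr]])
      then show ?thesis using cINF_lower[OF bdd r(1)] by simp
    qed
    then have "?I \<le> 0" by (rule field_le_epsilon[of _ 0, simplified])
    with I0 show "?I = 0" by simp
  qed
  then show ?thesis by (simp only: zeta0_eq_INF[OF f])
qed

end

text \<open>
  The filter on the field that is generated by unions of the disks over a member of \<open>U\<close>, with a common
  \<open>r\<close>. Along it, vanishing of \<open>\<zeta>\<^bsup>k,0\<^esup>(f)\<close> is convergence of \<open>f\<close> to \<open>0\<close>. The kernel thus becomes an instance
  of the same notion as \<open>{f. f(z\<^sub>n) \<rightarrow> 0}\<close>, and both are compared through their filters.
\<close>

definition shrinking_disks :: "(nat \<Rightarrow> 'a::nonarch_field) \<Rightarrow> nat filter \<Rightarrow> (nat \<Rightarrow> nat) \<Rightarrow> 'a filter" where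
  "shrinking_disks z U k =
    Abs_filter (\<lambda>P. \<exists>r\<in>{0<..<1}. \<forall>\<^sub>F n in U. \<forall>w\<in>root_disk z k r n. P w)"

lemma eventually_shrinking_disks:
  "eventually P (shrinking_disks z U k) \<longleftrightarrow>
    (\<exists>r\<in>{0<..<1}. \<forall>\<^sub>F n in U. \<forall>w\<in>root_disk z k r n. P w)"
  unfolding shrinking_disks_def
proof (rule eventually_Abs_filter, rule is_filter.intro)
  show "\<exists>r\<in>{0<..<1}. \<forall>\<^sub>F n in U. \<forall>w\<in>root_disk z k r n. True"
    by (intro bexI[of _ "1/2"]) auto
next
  fix P Q
  assume "\<exists>r\<in>{0<..<1}. \<forall>\<^sub>F n in U. \<forall>w\<in>root_disk z k r n. P w"
    "\<exists>r\<in>{0<..<1}. \<forall>\<^sub>F n in U. \<forall>w\<in>root_disk z k r n. Q w"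
  then obtain r s where r: "r \<in> {0<..<1}" "\<forall>\<^sub>F n in U. \<forall>w\<in>root_disk z k r n. P w"
    and s: "s \<in> {0<..<1}" "\<forall>\<^sub>F n in U. \<forall>w\<in>root_disk z k s n. Q w" by blast
  have sub: "closed_disk c (root m (min r s)) \<subseteq> closed_disk c (root m r)"
    "closed_disk c (root m (min r s)) \<subseteq> closed_disk c (root m s)" for c :: 'a and m
    by (intro closed_disk_mono root_mono min.cobounded1 min.cobounded2)+
  have "\<forall>\<^sub>F n in U. \<forall>w\<in>root_disk z k (min r s) n. P w \<and> Q w"
    using r(2) s(2) by eventually_elim (use sub in blast)
  moreover have "min r s \<in> {0<..<1}" using r s by auto
  ultimately show "\<exists>r\<in>{0<..<1}. \<forall>\<^sub>F n in U. \<forall>w\<in>root_disk z k r n. P w \<and> Q w"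
    by blast
next
  fix P Q :: "'a \<Rightarrow> bool"
  assume "\<forall>x. P x \<longrightarrow> Q x"
    "\<exists>r\<in>{0<..<1}. \<forall>\<^sub>F n in U. \<forall>w\<in>root_disk z k r n. P w"
  then show "\<exists>r\<in>{0<..<1}. \<forall>\<^sub>F n in U. \<forall>w\<in>root_disk z k r n. Q w"
    by (auto elim!: eventually_mono intro!: bexI)
qed

definition vanishing_along :: "'a::nonarch_field filter \<Rightarrow> 'a fps set" where
  "vanishing_along F = {f \<in> carrier Hinf. (evalH f \<longlongrightarrow> 0) F}"

lemma evalH_tendsto_0_iff:
  "(evalH f \<longlongrightarrow> 0) F \<longleftrightarrow> (\<forall>e>0. \<forall>\<^sub>F w in F. absv (evalH f w) < e)"
  by (simp add: tendsto_iff dist_absv)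

lemma kerH_zeta0_eq_vanishing_along:
  assumes "ultrafilter U" "\<And>n. z n \<in> unit_disk" "\<And>n. 1 \<le> k n"
  shows "kerH (zeta0 z U k) = vanishing_along (shrinking_disks z U k)"
  using zeta0_eq_0_iff[OF assms]
  by (auto simp: kerH_def vanishing_along_def evalH_tendsto_0_iff eventually_shrinking_disks)

lemma eventually_unit_disk_shrinking_disks:
  assumes "\<And>n. z n \<in> unit_disk" "\<And>n. 1 \<le> k n"
  shows "eventually (\<lambda>w. w \<in> unit_disk) (shrinking_disks z U k)"
proof -
  have "root_disk z k (1/2) n \<subseteq> unit_disk" for n
    using assms(2)[of n] by (intro closed_disk_subset_unit_disk assms(1)) simp
  then show ?thesis
    unfolding eventually_shrinking_disks
    by (intro bexI[of _ "1/2"] always_eventually) (auto simp: subset_iff)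
qed

lemma centers_le_shrinking_disks: "filtermap z U \<le> shrinking_disks z U k"
proof (rule filter_leI)
  fix P assume "eventually P (shrinking_disks z U k)"
  then obtain r where "r \<in> {0<..<1}" and ev: "\<forall>\<^sub>F n in U. \<forall>w\<in>root_disk z k r n. P w"
    unfolding eventually_shrinking_disks by blast
  then have "z n \<in> closed_disk (z n) (root (k n) r)" for n
    by (intro center_in_closed_disk real_root_ge_zero) auto
  with ev show "eventually P (filtermap z U)"
    unfolding eventually_filtermap by (auto elim!: eventually_mono)
qed

lemma Hinf_simps [simp]:
  "a \<oplus>\<^bsub>Hinf\<^esub> b = a + b" "a \<otimes>\<^bsub>Hinf\<^esub> b = a * b" "\<zero>\<^bsub>Hinf\<^esub> = 0" "\<one>\<^bsub>Hinf\<^esub> = 1"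
  by (simp_all add: Hinf_def)

lemma ideal_vanishing_along:
  fixes F :: "'a::nonarch_field filter"
  assumes F: "eventually (\<lambda>w. w \<in> unit_disk) F"
  shows "ideal (vanishing_along F) Hinf"
proof -
  interpret cring "Hinf :: 'a fps ring" by (rule cring_Hinf)
  have add: "f + g \<in> vanishing_along F" if "f \<in> vanishing_along F" "g \<in> vanishing_along F" for f g
  proof -
    have "((\<lambda>w. evalH f w + evalH g w) \<longlongrightarrow> 0) F"
      using that tendsto_add[of "evalH f" 0 F "evalH g" 0] by (simp add: vanishing_along_def)
    moreover have "\<forall>\<^sub>F w in F. evalH f w + evalH g w = evalH (f + g) w"
      using F that by (auto elim!: eventually_mono simp: vanishing_along_def unit_disk_def evalH_add)
    ultimately have "(evalH (f + g) \<longlongrightarrow> 0) F" by (rule Lim_transform_eventually)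
    then show ?thesis using that by (simp add: vanishing_along_def)
  qed
  have mult: "g * f \<in> vanishing_along F" if f: "f \<in> vanishing_along F" and g: "g \<in> carrier Hinf" for f g
  proof -
    obtain M where M: "coeff_le M g" using g carrier_Hinf_iff by blast
    have fc: "f \<in> carrier Hinf" and "(evalH f \<longlongrightarrow> 0) F" using f by (auto simp: vanishing_along_def)
    then have "((\<lambda>w. absv (evalH f w)) \<longlongrightarrow> 0) F"
      using tendsto_absv[of "evalH f" 0] by simp
    then have lim: "((\<lambda>w. M * absv (evalH f w)) \<longlongrightarrow> 0) F"
      by (rule tendsto_mult_right_zero)
    have "\<forall>\<^sub>F w in F. absv (evalH (g * f) w - 0) \<le> M * absv (evalH f w)"
      using F
    proof (rule eventually_mono)
      fix w :: 'a assume "w \<in> unit_disk"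
      then have "absv w < 1" by (simp add: unit_disk_def)
      then show "absv (evalH (g * f) w - 0) \<le> M * absv (evalH f w)"
        using absv_evalH_le[OF M] by (simp add: evalH_mult[OF g fc] absv_mult mult_right_mono)
    qed
    then have "((\<lambda>w. absv (evalH (g * f) w - 0)) \<longlongrightarrow> 0) F"
      by (intro tendsto_sandwich[OF _ _ tendsto_const lim]) auto
    then have "(evalH (g * f) \<longlongrightarrow> 0) F" by (rule tendsto_iff_absv[THEN iffD2])
    then show ?thesis using fc g by (simp add: vanishing_along_def)
  qed
  have zero: "0 \<in> vanishing_along F"
  proof -
    have "evalH (0 :: 'a fps) = (\<lambda>_. 0)" by (rule ext) simp
    then show ?thesis by (simp add: vanishing_along_def)
  qed
  have neg: "- f \<in> vanishing_along F" if "f \<in> vanishing_along F" for f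
    using mult[OF that, of "- 1"] by simp
  have inv: "inv\<^bsub>add_monoid Hinf\<^esub> f = - f" if "f \<in> carrier Hinf" for f :: "'a fps"
    using minus_equality[of "- f" f] that by (simp add: a_inv_def)
  show ?thesis
  proof (rule idealI)
    show "ring (Hinf :: 'a fps ring)" by (rule ring_axioms)
    show "subgroup (vanishing_along F) (add_monoid Hinf)"
      using add zero neg inv
      by (intro subgroup.intro) (auto simp: vanishing_along_def)
  qed (use mult in \<open>auto simp: mult.commute\<close>)
qed

lemma one_notin_vanishing_along:
  assumes "F \<noteq> bot"
  shows "1 \<notin> vanishing_along F"
proof
  assume "1 \<in> vanishing_along F"
  moreover have "evalH (1 :: 'a fps) = (\<lambda>_. 1)" by (rule ext) simp
  ultimately have "((\<lambda>_. 1 :: 'a) \<longlongrightarrow> 0) F" by (simp add: vanishing_along_def)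
  with assms show False by (simp add: tendsto_const_iff)
qed

section \<open>Maximality\<close>

text \<open>
  A function outside the ideal is bounded away from zero on a member of the ultrafilter, and
  interpolation inverts it there: with \<open>g = 1/f\<close> on that part of \<open>S\<close>, \<open>1 - g f\<close> vanishes on a
  member of the filter.
\<close>

theorem maximalideal_vanishing_along_ultrafilter:
  fixes F :: "'a::nonarch_field filter"
  assumes F: "ultrafilter F" "eventually (\<lambda>w. w \<in> S) F"
    and S: "S \<subseteq> unit_disk" "separated d S" "0 < d"
  shows "maximalideal (vanishing_along F) Hinf"
proof (rule maximalidealI)
  have disk: "eventually (\<lambda>w. w \<in> unit_disk) F"
    using F(2) S(1) by (auto elim: eventually_mono)
  then show "ideal (vanishing_along F) Hinf" by (rule ideal_vanishing_along)
  have "F \<noteq> bot" using F by (simp add: ultrafilter_def)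
  then show "carrier Hinf \<noteq> vanishing_along F"
    using one_notin_vanishing_along Hinf_1 by blast
  fix J :: "'a fps set"
  assume J: "ideal J Hinf" "vanishing_along F \<subseteq> J" "J \<subseteq> carrier Hinf"
  interpret J: ideal J Hinf by (rule J)
  have "J = carrier Hinf" if "J \<noteq> vanishing_along F"
  proof -
    obtain f where f: "f \<in> J" "f \<notin> vanishing_along F" using \<open>J \<noteq> vanishing_along F\<close> J(2) by blast
    have fc: "f \<in> carrier Hinf" using f J(3) by blast
    obtain e where e: "0 < e" "\<not> (\<forall>\<^sub>F w in F. absv (evalH f w) < e)"
      using f fc by (auto simp: vanishing_along_def evalH_tendsto_0_iff)
    have large: "\<forall>\<^sub>F w in F. \<not> absv (evalH f w) < e"
      using e(2) F(1) unfolding ultrafilter_def by blast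
    define a where "a w = (if absv (evalH f w) < e then 0 else inverse (evalH f w))" for w
    have "absv (a w) \<le> inverse e" for w
      using e(1) by (auto simp: a_def absv_inverse not_less le_imp_inverse_le)
    then obtain g where g: "g \<in> carrier Hinf" "\<And>w. w \<in> S \<Longrightarrow> evalH g w = a w"
      using interpolation_on_separated_set[OF S, of a "inverse e"] by blast
    have "\<forall>\<^sub>F w in F. evalH (1 - g * f) w = 0"
      using large F(2) disk
    proof eventually_elim
      fix w assume w: "\<not> absv (evalH f w) < e" "w \<in> S" "w \<in> unit_disk"
      then have "evalH f w \<noteq> 0" using e(1) by auto
      then show "evalH (1 - g * f) w = 0"
        using w g fc by (simp add: unit_disk_def evalH_diff evalH_mult a_def)
    qed
    then have "1 - g * f \<in> vanishing_along F"
      using g fc by (simp add: vanishing_along_def tendsto_eventually)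
    then have "1 - g * f \<in> J" using J(2) by blast
    from additive_subgroup.a_closed[OF ideal.axioms(1)[OF J(1)] this J.I_l_closed[OF f(1) g(1)]]
    have "\<one>\<^bsub>Hinf\<^esub> \<in> J" by simp
    then show ?thesis by (rule J.one_imp_carrier)
  qed
  then show "J = vanishing_along F \<or> J = carrier Hinf" by blast
qed

lemma vanishing_along_mono: "F \<le> G \<Longrightarrow> vanishing_along G \<subseteq> vanishing_along F"
  unfolding vanishing_along_def using tendsto_mono by blast

lemma ultrafilter_filtermap: "ultrafilter U \<Longrightarrow> ultrafilter (filtermap h U)"
  unfolding ultrafilter_def eventually_filtermap filtermap_bot_iff by blast

section \<open>Separated sets from regular sequences\<close>

lemma prod_le_prod_subset:
  fixes f :: "'b \<Rightarrow> real"
  assumes "finite A" "B \<subseteq> A" "\<And>i. i \<in> A \<Longrightarrow> 0 \<le> f i \<and> f i \<le> 1"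
  shows "prod f A \<le> prod f B"
proof -
  have "prod f A = prod f (A - B) * prod f B" using assms by (intro prod.subset_diff)
  also have "\<dots> \<le> 1 * prod f B"
    using assms by (intro mult_right_mono prod_le_1 prod_nonneg) auto
  finally show ?thesis by simp
qed

text \<open>
  The partial products decrease, so their limit exists and lies below every finite subproduct.
\<close>

lemma sep_prod_le_prod:
  fixes z :: "nat \<Rightarrow> 'a::nonarch_field"
  assumes z: "\<And>n. z n \<in> unit_disk" and F: "finite F" "F \<subseteq> C - {n}"
  shows "sep_prod z k C n \<le> (\<Prod>m\<in>F. absv (z n - z m) ^ k m)" "0 \<le> sep_prod z k C n"
proof -
  define A where "A N = {m \<in> C. m < N \<and> m \<noteq> n}" for N
  define p where "p N = (\<Prod>m\<in>A N. absv (z n - z m) ^ k m)" for N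
  have fin: "finite (A N)" for N by (rule finite_subset[of _ "{..<N}"]) (auto simp: A_def)
  have factor: "0 \<le> absv (z n - z m) ^ k m \<and> absv (z n - z m) ^ k m \<le> 1" for m
    using unit_disk_diff[OF z z, of n m] by (auto simp: unit_disk_def intro: power_le_one)
  have dec: "decseq p"
    unfolding decseq_def p_def
    by (intro allI impI prod_le_prod_subset fin factor) (auto simp: A_def)
  have nonneg: "0 \<le> p N" for N unfolding p_def using factor by (intro prod_nonneg) blast
  obtain L where L: "p \<longlonglongrightarrow> L" "\<forall>N. L \<le> p N"
    using decseq_convergent[OF dec allI[OF nonneg]] by blast
  have sep: "sep_prod z k C n = L"
    unfolding sep_prod_def using limI[OF L(1)] by (simp add: p_def[abs_def] A_def)
  then show "0 \<le> sep_prod z k C n" using LIMSEQ_le_const[OF L(1)] nonneg by blast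
  obtain N where "\<forall>m\<in>F. m < N" using finite_nat_set_iff_bounded[of F] F(1) by blast
  then have "p N \<le> (\<Prod>m\<in>F. absv (z n - z m) ^ k m)"
    unfolding p_def using F(2) by (intro prod_le_prod_subset fin factor) (auto simp: A_def)
  then show "sep_prod z k C n \<le> (\<Prod>m\<in>F. absv (z n - z m) ^ k m)"
    using L(2) sep order_trans by blast
qed

lemma separated_image_if_regular:
  fixes z :: "nat \<Rightarrow> 'a::nonarch_field"
  assumes z: "\<And>n. z n \<in> unit_disk" and reg: "regular_wrt U z"
  shows "\<exists>C d. eventually (\<lambda>n. n \<in> C) U \<and> 0 < d \<and> d \<le> 1 \<and> separated d (z ` C)"
proof -
  obtain C where C: "eventually (\<lambda>n. n \<in> C) U" and pos: "(INF n\<in>C. sep_prod z (\<lambda>_. 1) C n) > 0"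
    using reg unfolding regular_wrt_def by blast
  define d where "d = min 1 (INF n\<in>C. sep_prod z (\<lambda>_. 1) C n)"
  have d: "0 < d" "d \<le> 1" using pos by (auto simp: d_def)
  have bdd: "bdd_below ((\<lambda>n. sep_prod z (\<lambda>_. 1) C n) ` C)"
    using sep_prod_le_prod(2)[OF z, of "{}"] by (intro bdd_belowI2[where m = 0]) auto
  have prod_ge: "d \<le> (\<Prod>m\<in>F. absv (z n - z m))" if "n \<in> C" "finite F" "F \<subseteq> C - {n}" for n F
  proof -
    have "d \<le> sep_prod z (\<lambda>_. 1) C n" using cINF_lower[OF bdd that(1)] by (simp add: d_def)
    also have "\<dots> \<le> (\<Prod>m\<in>F. absv (z n - z m))"
      using sep_prod_le_prod(1)[where z = z and k = "\<lambda>_. 1", OF z that(2,3)] by simp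
    finally show ?thesis .
  qed
  have "separated d (z ` C)"
    unfolding separated_def
  proof (intro ballI allI impI)
    fix w G assume w: "w \<in> z ` C" and G: "finite G" "G \<subseteq> z ` C - {w}"
    obtain n where n: "n \<in> C" "w = z n" using w by blast
    obtain F where F: "F \<subseteq> C" "inj_on z F" "G = z ` F"
      using G(2) subset_image_inj[of G z C] by blast
    have "finite F" using F G(1) finite_image_iff by blast
    moreover have "F \<subseteq> C - {n}" using F G(2) n by auto
    ultimately show "d \<le> (\<Prod>v\<in>G. absv (w - v))"
      using prod_ge[OF n(1)] F n(2) by (simp add: prod.reindex)
  qed
  with C d show ?thesis by blast
qed

lemma separated_imp_dist_ge:
  assumes "separated d S" "w \<in> S" "v \<in> S" "v \<noteq> w"
  shows "d \<le> absv (w - v)"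
  using assms(1)[unfolded separated_def, rule_format, OF assms(2), of "{v}"] assms(3,4) by simp

text \<open>
  Applied to a single factor, separation says that distinct points of \<open>S\<close> have distance at least
  \<open>d > |p|\<close>. Hence moving points by \<open>p\<close> changes none of their distances. The product at
  a point of the larger set splits into one product over \<open>S\<close>, one over the translate, and the factor
  \<open>|p|\<close> that comes from the partner of the point.
\<close>

lemma separated_union_translate:
  fixes S :: "'a::nonarch_field set"
  assumes S: "separated d S" and p: "p \<noteq> 0" "absv p < d" and d: "d \<le> 1"
  shows "separated (absv p * (d * d)) (S \<union> (\<lambda>w. w + p) ` S)"
  unfolding separated_def
proof (intro ballI allI impI)
  let ?T = "(\<lambda>w. w + p) ` S"
  fix u F assume u: "u \<in> S \<union> ?T" and F: "finite F" "F \<subseteq> S \<union> ?T - {u}"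
  obtain w i where w: "w \<in> S" "u = w + i" "i = 0 \<or> i = p" using u by fastforce
  have perturb: "absv (w - v + j) = absv (w - v)" if "v \<in> S" "v \<noteq> w" "absv j \<le> absv p" for v j
    using separated_imp_dist_ge[OF S w(1) that(1,2)] that(3) p(2) absv_add_eq_right[of j "w - v"]
    by (simp add: add.commute)
  have disj: "v + p \<notin> S" if "v \<in> S" for v
    using separated_imp_dist_ge[OF S that, of "v + p"] p by (auto simp: absv_minus)
  define F0 where "F0 = F \<inter> {w, w + p}"
  define F1 where "F1 = F \<inter> S - {w}"
  define F2 where "F2 = F \<inter> ?T - {w + p}"
  have F1: "F1 \<subseteq> S - {w}" by (auto simp: F1_def)
  have split: "F = F0 \<union> (F1 \<union> F2)" using F(2) by (auto simp: F0_def F1_def F2_def)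
  have dj: "F0 \<inter> (F1 \<union> F2) = {}" "F1 \<inter> F2 = {}"
    using disj w(1) by (auto simp: F0_def F1_def F2_def)
  have fin: "finite F0" "finite F1" "finite F2" using F(1) by (auto simp: F0_def F1_def F2_def)
  let ?P = "\<lambda>A. \<Prod>v\<in>A. absv (u - v)"
  have 0: "absv p \<le> ?P F0"
  proof -
    have "F0 \<subseteq> {w + (p - i)}" using w F(2) by (auto simp: F0_def)
    then consider "F0 = {}" | "F0 = {w + (p - i)}" by blast
    then show ?thesis
    proof cases
      case 2
      have "absv (u - (w + (p - i))) = absv p" using w(2,3) by auto
      then show ?thesis using 2 by simp
    qed (use p d in simp)
  qed
  have 1: "d \<le> ?P F1"
  proof -
    have "?P F1 = (\<Prod>v\<in>F1. absv (w - v))"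
    proof (intro prod.cong refl)
      fix v assume "v \<in> F1"
      then show "absv (u - v) = absv (w - v)"
        using perturb[of v i] w by (auto simp: F1_def algebra_simps)
    qed
    also have "d \<le> \<dots>" using S w(1) F1 fin(2) unfolding separated_def by blast
    finally show ?thesis .
  qed
  have 2: "d \<le> ?P F2"
  proof -
    define G where "G = (\<lambda>v. v - p) ` F2"
    have G: "G \<subseteq> S - {w}" "finite G" using fin by (auto simp: G_def F2_def)
    have "?P F2 = (\<Prod>v\<in>G. absv (u - (v + p)))"
      unfolding G_def by (subst prod.reindex) (auto simp: inj_on_def)
    also have "\<dots> = (\<Prod>v\<in>G. absv (w - v))"
    proof (intro prod.cong refl)
      fix v assume "v \<in> G"
      then have "v \<in> S" "v \<noteq> w" using G by auto
      then show "absv (u - (v + p)) = absv (w - v)"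
        using perturb[of v "i - p"] w(2,3) by (auto simp: algebra_simps)
    qed
    also have "d \<le> \<dots>" using S w(1) G unfolding separated_def by blast
    finally show ?thesis .
  qed
  have "0 < d" using p(2) absv_nonneg[of p] by linarith
  then have "absv p * (d * d) \<le> ?P F0 * (?P F1 * ?P F2)"
    by (intro mult_mono 0 1 2 mult_nonneg_nonneg prod_nonneg absv_nonneg) simp_all
  also have "\<dots> = ?P (F0 \<union> (F1 \<union> F2))"
    using dj fin by (simp add: prod.union_disjoint)
  also have "\<dots> = ?P F" using arg_cong[OF split, of ?P] by (rule sym)
  finally show "absv p * (d * d) \<le> ?P F" .
qed

section \<open>Comparison of the two ideals\<close>

text \<open>
  For an ultrafilter, failure of \<open>k \<rightarrow> \<infinity>\<close> means \<open>k < K\<close> on a member of \<open>U\<close>. The disks with \<open>r = s\<^bsup>K+1\<^esup>\<close>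
  then have radius at most \<open>s\<close>, and on them \<open>f\<close> differs from \<open>f(z\<^sub>n)\<close> by at most \<open>M s\<close>.
\<close>

lemma vanishing_along_shrinking_disks_if_not_at_top:
  assumes z: "\<And>n. z n \<in> unit_disk" and k1: "\<And>n. 1 \<le> k n"
    and U: "ultrafilter U" and k: "\<not> filterlim k at_top U"
  shows "vanishing_along (shrinking_disks z U k) = vanishing_along (filtermap z U)"
proof
  show "vanishing_along (shrinking_disks z U k) \<subseteq> vanishing_along (filtermap z U)"
    by (rule vanishing_along_mono[OF centers_le_shrinking_disks])
  obtain K where "\<not> (\<forall>\<^sub>F n in U. K \<le> k n)" using k unfolding filterlim_at_top by blast
  then have K: "\<forall>\<^sub>F n in U. \<not> K \<le> k n" using U unfolding ultrafilter_def by blast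
  show "vanishing_along (filtermap z U) \<subseteq> vanishing_along (shrinking_disks z U k)"
  proof
    fix f assume f: "f \<in> vanishing_along (filtermap z U)"
    then have fc: "f \<in> carrier Hinf" by (simp add: vanishing_along_def)
    then obtain M where M: "coeff_le M f" using carrier_Hinf_iff by blast
    have M0: "0 \<le> M" using coeff_le_nonneg[OF M] .
    have "\<forall>\<^sub>F w in shrinking_disks z U k. absv (evalH f w) < e" if e: "0 < e" for e
    proof -
      define s where "s = min (1/2) (e / (2 * (M + 1)))"
      have s: "0 < s" "s < 1" using e M0 by (auto simp: s_def)
      have "M * s \<le> (M + 1) * (e / (2 * (M + 1)))"
        using M0 s e by (intro mult_mono) (auto simp: s_def)
      also have "\<dots> = e / 2" using M0 by (simp add: field_simps)
      also have "\<dots> < e" using e by simp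
      finally have Ms: "M * s < e" .
      have ev: "\<forall>\<^sub>F n in U. absv (evalH f (z n)) < e"
        using f e by (simp add: vanishing_along_def evalH_tendsto_0_iff eventually_filtermap)
      have "\<forall>\<^sub>F n in U. \<forall>w\<in>root_disk z k (s ^ Suc K) n. absv (evalH f w) < e"
        using ev K
      proof eventually_elim
        fix n assume fn: "absv (evalH f (z n)) < e" and kn: "\<not> K \<le> k n"
        have "s ^ Suc K \<le> s ^ k n" using s kn by (intro power_decreasing) auto
        then have "root (k n) (s ^ Suc K) \<le> root (k n) (s ^ k n)" by (rule root_mono)
        also have "\<dots> = s" using s k1[of n] by (intro real_root_power_cancel) auto
        finally have rs: "root (k n) (s ^ Suc K) \<le> s" .
        show "\<forall>w\<in>root_disk z k (s ^ Suc K) n. absv (evalH f w) < e"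
        proof
          fix w assume w: "w \<in> root_disk z k (s ^ Suc K) n"
          then have ws: "absv (w - z n) \<le> s" using rs by (simp add: closed_disk_def)
          have wd: "absv w < 1"
            using closed_disk_subset_unit_disk[OF z s(2)] ws
            by (auto simp: closed_disk_def unit_disk_def)
          have "absv (evalH f w - evalH f (z n)) \<le> M * absv (w - z n)"
            using z[of n] by (intro absv_evalH_diff_le[OF M wd]) (simp add: unit_disk_def)
          also have "\<dots> \<le> M * s" using ws M0 by (rule mult_left_mono)
          finally show "absv (evalH f w) < e"
            using absv_ultrametric[of "evalH f w - evalH f (z n)" "evalH f (z n)"] Ms fn by simp
        qed
      qed
      moreover have "s ^ Suc K \<in> {0<..<1}"
        using s power_less_one_iff[of s "Suc K"] by (simp del: power_Suc)
      ultimately show ?thesis unfolding eventually_shrinking_disks by blast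
    qed
    then show "f \<in> vanishing_along (shrinking_disks z U k)"
      using fc by (simp add: vanishing_along_def evalH_tendsto_0_iff)
  qed
qed

text \<open>
  The witness is a function that is \<open>0\<close> at every \<open>z\<^sub>n\<close> and \<open>1\<close> at every \<open>z\<^sub>n + p\<close>. For given \<open>r\<close> the radius
  \<open>r\<^bsup>1/k\<^sub>n\<^esup>\<close> is at least \<open>|p|\<close> as soon as \<open>|p|\<^bsup>k\<^sub>n\<^esup> \<le> r\<close>, which holds eventually because \<open>k \<rightarrow> \<infinity>\<close>.
\<close>

lemma vanishing_along_shrinking_disks_psubset_if_at_top:
  assumes z: "\<And>n. z n \<in> unit_disk" and k1: "\<And>n. 1 \<le> k n" and U: "U \<noteq> bot"
    and C: "eventually (\<lambda>n. n \<in> C) U" and d: "0 < d" "d \<le> 1" "separated d (z ` C)"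
    and k: "filterlim k at_top U"
  shows "vanishing_along (shrinking_disks z U k) \<subset> vanishing_along (filtermap z U)"
proof -
  let ?S = "z ` C"
  have S: "?S \<subseteq> unit_disk" using z by blast
  obtain p :: 'a where p: "p \<noteq> 0" "absv p < d" using ex_small_absv[OF d(1)] by blast
  have disj: "z n + p \<notin> ?S" if "n \<in> C" for n
    using separated_imp_dist_ge[OF d(3), of "z n" "z n + p"] that p by auto
  have "z n + p \<in> unit_disk" for n
    using closed_disk_subset_unit_disk[OF z, of "absv p" n] p d by (auto simp: closed_disk_def)
  then have sub: "?S \<union> (\<lambda>w. w + p) ` ?S \<subseteq> unit_disk" using S by auto
  let ?a = "\<lambda>w. of_bool (w \<notin> ?S) :: 'a"
  have "0 < absv p * (d * d)" using p d by simp
  moreover have "absv (?a w) \<le> 1" for w by simp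
  ultimately have "\<exists>f\<in>carrier Hinf. \<forall>w\<in>?S \<union> (\<lambda>w. w + p) ` ?S. evalH f w = ?a w"
    by (intro interpolation_on_separated_set[OF sub separated_union_translate[OF d(3) p d(2)]])
  then obtain f where f: "f \<in> carrier Hinf"
    "\<And>w. w \<in> ?S \<union> (\<lambda>w. w + p) ` ?S \<Longrightarrow> evalH f w = ?a w" by blast
  have f0: "evalH f (z n) = 0" and f1: "evalH f (z n + p) = 1" if "n \<in> C" for n
    using f(2)[of "z n"] f(2)[of "z n + p"] disj[OF that] that by auto
  have "\<forall>\<^sub>F w in filtermap z U. evalH f w = 0"
    unfolding eventually_filtermap using C by (rule eventually_mono) (rule f0)
  then have "f \<in> vanishing_along (filtermap z U)"
    using f(1) by (simp add: vanishing_along_def tendsto_eventually)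
  moreover have "f \<notin> vanishing_along (shrinking_disks z U k)"
  proof
    assume "f \<in> vanishing_along (shrinking_disks z U k)"
    then have "\<forall>\<^sub>F w in shrinking_disks z U k. absv (evalH f w) < 1"
      by (simp add: vanishing_along_def evalH_tendsto_0_iff)
    then obtain r where r: "r \<in> {0<..<1}"
      and ev: "\<forall>\<^sub>F n in U. \<forall>w\<in>root_disk z k r n. absv (evalH f w) < 1"
      unfolding eventually_shrinking_disks by blast
    obtain K where K: "absv p ^ K < r"
      using real_arch_pow_inv[of r "absv p"] r p d by auto
    have "\<forall>\<^sub>F n in U. K \<le> k n" using k unfolding filterlim_at_top by blast
    with ev C have "\<forall>\<^sub>F n in U. False"
    proof eventually_elim
      fix n assume small: "\<forall>w\<in>root_disk z k r n. absv (evalH f w) < 1" and n: "n \<in> C" and kn: "K \<le> k n"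
      have "absv p ^ k n \<le> absv p ^ K" using kn p d by (intro power_decreasing) auto
      then have "root (k n) (absv p ^ k n) \<le> root (k n) r" using K by (intro root_mono) auto
      moreover have "root (k n) (absv p ^ k n) = absv p"
        using k1[of n] by (intro real_root_power_cancel) auto
      ultimately have "z n + p \<in> root_disk z k r n" by (simp add: closed_disk_def)
      with small f1[OF n] show False by force
    qed
    with U show False by (simp add: trivial_limit_def)
  qed
  ultimately show ?thesis
    using vanishing_along_mono[OF centers_le_shrinking_disks] by blast
qed

theorem corollary2p8:
  fixes z :: "nat \<Rightarrow> 'a::nonarch_field" and U :: "nat filter" and k :: "nat \<Rightarrow> nat"
  assumes "nonprincipal_ultrafilter U"
    and "\<And>n. z n \<in> unit_disk"
    and "regular_wrt U z"
    and "k \<in> Comp U z"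
  shows "(ideal (kerH (zeta0 z U k)) Hinf \<and> \<not> maximalideal (kerH (zeta0 z U k)) Hinf)
    \<longleftrightarrow> filterlim k at_top U"
proof -
  have U: "ultrafilter U" using assms(1) by (simp add: nonprincipal_ultrafilter_def)
  then have "U \<noteq> bot" by (simp add: ultrafilter_def)
  note z = assms(2)
  have k1: "1 \<le> k n" for n using assms(4) by (simp add: Comp_def)
  obtain C d where C: "eventually (\<lambda>n. n \<in> C) U" and d: "0 < d" "d \<le> 1" "separated d (z ` C)"
    using separated_image_if_regular[OF z assms(3)] by blast
  let ?J = "vanishing_along (filtermap z U)"
  have ker: "kerH (zeta0 z U k) = vanishing_along (shrinking_disks z U k)"
    by (rule kerH_zeta0_eq_vanishing_along[OF U z k1])
  have J: "maximalideal ?J Hinf"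
  proof (rule maximalideal_vanishing_along_ultrafilter)
    show "eventually (\<lambda>w. w \<in> z ` C) (filtermap z U)"
      unfolding eventually_filtermap using C by (auto elim: eventually_mono)
  qed (use U z d in \<open>auto intro: ultrafilter_filtermap\<close>)
  have ideal: "ideal (kerH (zeta0 z U k)) Hinf"
    unfolding ker by (intro ideal_vanishing_along eventually_unit_disk_shrinking_disks z k1)
  show ?thesis
  proof
    assume lhs: "ideal (kerH (zeta0 z U k)) Hinf \<and> \<not> maximalideal (kerH (zeta0 z U k)) Hinf"
    show "filterlim k at_top U"
    proof (rule ccontr)
      assume "\<not> filterlim k at_top U"
      then have "kerH (zeta0 z U k) = ?J"
        unfolding ker by (rule vanishing_along_shrinking_disks_if_not_at_top[OF z k1 U])
      with J lhs show False by simp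
    qed
  next
    assume k: "filterlim k at_top U"
    have proper: "kerH (zeta0 z U k) \<subset> ?J"
      unfolding ker
      by (rule vanishing_along_shrinking_disks_psubset_if_at_top[OF z k1 \<open>U \<noteq> bot\<close> C d k])
    have "\<not> maximalideal (kerH (zeta0 z U k)) Hinf"
    proof
      assume "maximalideal (kerH (zeta0 z U k)) Hinf"
      then have "?J = kerH (zeta0 z U k) \<or> ?J = carrier Hinf"
        using proper J
        by (intro maximalideal.I_maximal) (auto simp: maximalideal_def vanishing_along_def)
      with proper maximalideal.I_notcarr[OF J] show False by auto
    qed
    with ideal show "ideal (kerH (zeta0 z U k)) Hinf \<and> \<not> maximalideal (kerH (zeta0 z U k)) Hinf"
      by blast
  qed
qed

end
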